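(* Let $f:\mathbb{R}^n\to\mathbb{R}^n$ have bounded second derivatives, let $\Gamma,\sigma\in\mathbb{R}^{n\times n}$ be constant matrices with $\sigma\sigma^T=2k_B\Theta\,\Gamma$, and let $z(t)=(x(t),v(t))$, $0\le t\le T$, be the solution of the Langevin equation $$dx=v\,dt,\qquad dv=f(x)\,dt-\Gamma v\,dt+\sigma\,dW_t .$$ Then both the symmetric splitting method $z_{k+1}=\exp(A/2)\exp(B)\exp(A/2)z_k$ and the non-symmetric splitting method $z_{k+1}=\exp(A)\exp(B)z_k$, with $A$ and $B$ the direct splitting of the Langevin equation defined in the context, have strong order $1$.
   Context: $W=(W^1,\dots,W^n)$ is a standard $n$-dimensional Brownian motion, $k_B$ is Boltzmann's constant and $\Theta$ is the temperature (a constant). The interval $[0,T]$ is discretized uniformly: $t_k=k\Delta t$, $k=0,\dots,n_T$, $n_T\Delta t=T$. The numerical solution $z_k=(x_k,v_k)$ starts from the same initial value as the exact solution and is driven by the same Brownian motion. Strong order: a discrete-time approximation $Y=Y^{\Delta t}$ of $X$ with uniform step size $\Delta t$ converges with (has) strong order $\gamma\in\{0.5,1,1.5,2,\dots\}$ at time $T>0$ if there are constants $C$ and $\Delta>0$ such that $$\mathbb{E}\Big(\sup_{0\le k\le n_T}|X(k\Delta t)-Y(k\Delta t)|\Big)\le C\,\Delta t^{\gamma}\quad\text{for all }0<\Delta t<\Delta .$$ Splitting: on the step $[t_k,t_{k+1}]$, $\exp(A)$ and $\exp(A/2)$ denote the exact solution map, over a time of length $\Delta t$ and $\Delta t/2$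 respectively, of the system $x'=v,\ v'=0$. $\exp(B)$ denotes the exact solution map over $[t_k,t_{k+1}]$ (with the increments of $W$ on that interval) of the system $dx=0$, $dv=f(x)\,dt-\Gamma v\,dt+\sigma\,dW_t$. Products are compositions of maps, the rightmost factor being applied first.
   Formalization: The formal theorem additionally assumes that f is globally Lipschitz and that E|z(0)| is finite; with only bounded second derivatives the claim fails, e.g. for n=1, f(x) = -x sqrt(1+x^2), Γ=1, σ=sqrt 2, where the expected error of the splitting diverges. *)

theory Defs
  imports "HOL-Probability.Probability"
begin

definition standard_brownian_motion_1 :: "'w measure \<Rightarrow> (real \<Rightarrow> 'w \<Rightarrow> real) \<Rightarrow> bool" where
  "standard_brownian_motion_1 M B \<longleftrightarrow>
     prob_space M \<and>
     (\<forall>t\<ge>0. B t \<in> borel_measurable M) \<and>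
     (AE \<omega> in M. B 0 \<omega> = 0) \<and>
     (\<forall>\<omega>\<in>space M. continuous_on {0..} (\<lambda>t. B t \<omega>)) \<and>
     (\<forall>s t. 0 \<le> s \<and> s < t \<longrightarrow>
        distributed M lborel (\<lambda>\<omega>. B t \<omega> - B s \<omega>) (normal_density 0 (sqrt (t - s)))) \<and>
     (\<forall>(\<tau> :: nat \<Rightarrow> real) m. 0 \<le> \<tau> 0 \<and> mono \<tau> \<longrightarrow>
        prob_space.indep_vars M (\<lambda>_. borel) (\<lambda>j \<omega>. B (\<tau> (Suc j)) \<omega> - B (\<tau> j) \<omega>) {..<m})"

text \<open>The components are independent as processes, i.e. as random elements of the space of
  functions on \<open>[0, \<infinity>)\<close> with the product sigma-algebra.\<close>

definition standard_brownian_motion ::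
  "'w measure \<Rightarrow> (real \<Rightarrow> 'w \<Rightarrow> real ^ 'n) \<Rightarrow> bool" where
  "standard_brownian_motion M W \<longleftrightarrow>
     (\<forall>i. standard_brownian_motion_1 M (\<lambda>t \<omega>. W t \<omega> $ i)) \<and>
     prob_space.indep_vars M (\<lambda>_. PiM {0..} (\<lambda>_. borel))
       (\<lambda>i \<omega>. restrict (\<lambda>t. W t \<omega> $ i) {0..}) UNIV"

text \<open>Differential equations \<open>dz = b(z) dt + dN\<close> along one path \<open>N\<close> of the driving noise. All noise
  coefficients below are constant matrices, so the stochastic integral of the coefficient from
  \<open>s\<close> to \<open>r\<close> is the increment \<open>N r - N s\<close>, and the stochastic equation is a pathwise
  integral equation.\<close>

definition solves ::
  "('a::euclidean_space \<Rightarrow> 'a) \<Rightarrow> (real \<Rightarrow> 'a) \<Rightarrow> real \<Rightarrow> real \<Rightarrow> 'a \<Rightarrow> (real \<Rightarrow> 'a) \<Rightarrow> bool" where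
  "solves b N s t z\<^sub>0 z \<longleftrightarrow>
     continuous_on {s..t} z \<and>
     (\<forall>r\<in>{s..t}. ((\<lambda>q. b (z q)) has_integral (z r - z\<^sub>0 - (N r - N s))) {s..r})"

definition solution_map ::
  "('a::euclidean_space \<Rightarrow> 'a) \<Rightarrow> (real \<Rightarrow> 'a) \<Rightarrow> real \<Rightarrow> real \<Rightarrow> 'a \<Rightarrow> 'a" where
  "solution_map b N s t z\<^sub>0 = (THE z\<^sub>1. \<exists>z. solves b N s t z\<^sub>0 z \<and> z t = z\<^sub>1)"

definition drift_A :: "(real ^ 'n) \<times> (real ^ 'n) \<Rightarrow> (real ^ 'n) \<times> (real ^ 'n)" where
  "drift_A = (\<lambda>(x, v). (v, 0))"

definition drift_B ::
  "(real ^ 'n \<Rightarrow> real ^ 'n) \<Rightarrow> real ^ 'n ^ 'n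
    \<Rightarrow> (real ^ 'n) \<times> (real ^ 'n) \<Rightarrow> (real ^ 'n) \<times> (real ^ 'n)" where
  "drift_B f \<Gamma> = (\<lambda>(x, v). (0, f x - \<Gamma> *v v))"

definition langevin_drift ::
  "(real ^ 'n \<Rightarrow> real ^ 'n) \<Rightarrow> real ^ 'n ^ 'n
    \<Rightarrow> (real ^ 'n) \<times> (real ^ 'n) \<Rightarrow> (real ^ 'n) \<times> (real ^ 'n)" where
  "langevin_drift f \<Gamma> = (\<lambda>(x, v). (v, f x - \<Gamma> *v v))"

definition noise :: "real ^ 'n ^ 'n \<Rightarrow> (real \<Rightarrow> real ^ 'n) \<Rightarrow> real \<Rightarrow> (real ^ 'n) \<times> (real ^ 'n)" where
  "noise \<sigma> w t = (0, \<sigma> *v w t)"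

definition langevin_solution ::
  "'w measure \<Rightarrow> (real ^ 'n \<Rightarrow> real ^ 'n) \<Rightarrow> real ^ 'n ^ 'n \<Rightarrow> real ^ 'n ^ 'n
    \<Rightarrow> (real \<Rightarrow> 'w \<Rightarrow> real ^ 'n) \<Rightarrow> real \<Rightarrow> (real \<Rightarrow> 'w \<Rightarrow> (real ^ 'n) \<times> (real ^ 'n)) \<Rightarrow> bool" where
  "langevin_solution M f \<Gamma> \<sigma> W T z \<longleftrightarrow>
     (\<forall>t\<in>{0..T}. z t \<in> borel_measurable M) \<and>
     (AE \<omega> in M. solves (langevin_drift f \<Gamma>) (noise \<sigma> (\<lambda>t. W t \<omega>)) 0 T (z 0 \<omega>) (\<lambda>t. z t \<omega>))"

definition exp_A :: "real \<Rightarrow> (real ^ 'n) \<times> (real ^ 'n) \<Rightarrow> (real ^ 'n) \<times> (real ^ 'n)" where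
  "exp_A \<tau> = solution_map drift_A (\<lambda>_. 0) 0 \<tau>"

definition exp_B ::
  "(real ^ 'n \<Rightarrow> real ^ 'n) \<Rightarrow> real ^ 'n ^ 'n \<Rightarrow> real ^ 'n ^ 'n \<Rightarrow> (real \<Rightarrow> real ^ 'n)
    \<Rightarrow> real \<Rightarrow> real \<Rightarrow> (real ^ 'n) \<times> (real ^ 'n) \<Rightarrow> (real ^ 'n) \<times> (real ^ 'n)" where
  "exp_B f \<Gamma> \<sigma> w s t = solution_map (drift_B f \<Gamma>) (noise \<sigma> w) s t"

primrec symmetric_splitting ::
  "(real ^ 'n \<Rightarrow> real ^ 'n) \<Rightarrow> real ^ 'n ^ 'n \<Rightarrow> real ^ 'n ^ 'n \<Rightarrow> (real \<Rightarrow> real ^ 'n)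
    \<Rightarrow> (real ^ 'n) \<times> (real ^ 'n) \<Rightarrow> real \<Rightarrow> nat \<Rightarrow> (real ^ 'n) \<times> (real ^ 'n)" where
  "symmetric_splitting f \<Gamma> \<sigma> w z\<^sub>0 h 0 = z\<^sub>0"
| "symmetric_splitting f \<Gamma> \<sigma> w z\<^sub>0 h (Suc k) =
     (exp_A (h / 2) \<circ> exp_B f \<Gamma> \<sigma> w (real k * h) (real (Suc k) * h) \<circ> exp_A (h / 2))
       (symmetric_splitting f \<Gamma> \<sigma> w z\<^sub>0 h k)"

primrec nonsymmetric_splitting ::
  "(real ^ 'n \<Rightarrow> real ^ 'n) \<Rightarrow> real ^ 'n ^ 'n \<Rightarrow> real ^ 'n ^ 'n \<Rightarrow> (real \<Rightarrow> real ^ 'n)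
    \<Rightarrow> (real ^ 'n) \<times> (real ^ 'n) \<Rightarrow> real \<Rightarrow> nat \<Rightarrow> (real ^ 'n) \<times> (real ^ 'n)" where
  "nonsymmetric_splitting f \<Gamma> \<sigma> w z\<^sub>0 h 0 = z\<^sub>0"
| "nonsymmetric_splitting f \<Gamma> \<sigma> w z\<^sub>0 h (Suc k) =
     (exp_A h \<circ> exp_B f \<Gamma> \<sigma> w (real k * h) (real (Suc k) * h))
       (nonsymmetric_splitting f \<Gamma> \<sigma> w z\<^sub>0 h k)"

text \<open>\<open>Y h k\<close> is the approximation with step size \<open>h\<close> at time \<open>k * h\<close>; only step sizes that
  divide \<open>T\<close> are considered. Integrability is required explicitly because the Bochner integral of
  a non-integrable function is 0.\<close>

definition has_strong_order ::
  "'w measure \<Rightarrow> real \<Rightarrow> (real \<Rightarrow> 'w \<Rightarrow> 'a::euclidean_space) \<Rightarrow> (real \<Rightarrow> nat \<Rightarrow> 'w \<Rightarrow> 'a)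
    \<Rightarrow> real \<Rightarrow> bool" where
  "has_strong_order M T X Y \<gamma> \<longleftrightarrow>
     (\<exists>m::nat. m \<ge> 1 \<and> \<gamma> = real m / 2) \<and>
     (\<exists>C \<Delta>. \<Delta> > 0 \<and>
       (\<forall>h N. 0 < h \<and> h < \<Delta> \<and> real N * h = T \<longrightarrow>
          integrable M (\<lambda>\<omega>. SUP k\<in>{0..N}. norm (X (real k * h) \<omega> - Y h k \<omega>)) \<and>
          (\<integral>\<omega>. (SUP k\<in>{0..N}. norm (X (real k * h) \<omega> - Y h k \<omega>)) \<partial>M) \<le> C * h powr \<gamma>))"

definition has_bounded_second_derivatives ::
  "('a::real_normed_vector \<Rightarrow> 'b::real_normed_vector) \<Rightarrow> bool" where
  "has_bounded_second_derivatives f \<longleftrightarrow>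
     (\<exists>(f' :: 'a \<Rightarrow> 'a \<Rightarrow>\<^sub>L 'b) (f'' :: 'a \<Rightarrow> 'a \<Rightarrow>\<^sub>L ('a \<Rightarrow>\<^sub>L 'b)).
        (\<forall>x. (f has_derivative blinfun_apply (f' x)) (at x)) \<and>
        (\<forall>x. (f' has_derivative blinfun_apply (f'' x)) (at x)) \<and>
        bounded (range f''))"

end

theory Submission
  imports Defs
begin

text \<open>That the order is 1 and not \<open>1/2\<close> is due to a cancellation between independent noise contributions; all the rest is a
pathwise estimate.

Both methods are the composition \<open>exp(\<theta>A) exp(B) exp((1-\<theta>)A)\<close>, with \<open>\<theta> = 1/2\<close> and \<open>\<theta> = 1\<close>. One step
from \<open>(x, v)\<close> moves the velocity along its own linear equation with the position frozen at
\<open>P = x + (1-\<theta>)hv\<close>, which produces \<open>v'\<close>, and then puts \<open>x' = x + h((1-\<theta>)v + \<theta>v')\<close>. Compare one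
step with the exact solution on the same noise path. In the velocity the noise cancels. What drives
the difference is \<open>f(x(s)) - f(P)\<close> and the damping of the difference itself, and the two positions differ by \<open>O(h)\<close> plus the
error already made; so the velocity has a local error \<open>O(h\<^sup>2)\<close>. In the position the local error is that of the quadrature of
\<open>\<integral> v\<close> by \<open>h((1-\<theta>)v(t\<^sub>k) + \<theta>v(t\<^sub>k\<^sub>+\<^sub>1))\<close>. Since \<open>v\<close> is \<open>\<sigma>W\<close> plus a Lipschitz function of time, this is \<open>O(h\<^sup>2)\<close>
plus \<open>\<sigma>\<close> times the same quadrature error for the Brownian path, a quantity of size \<open>h\<^bsup>3/2\<^esup>\<close>.

Added up in absolute value over \<open>T/h\<close> steps, the Brownian quadrature errors would only give order \<open>1/2\<close>. But
their sum is a limit of sums \<open>\<Sum> a\<^sub>j (B(t\<^sub>j\<^sub>+\<^sub>1) - B(t\<^sub>j))\<close> over ever finer grids, with deterministic weights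
\<open>\<bar>a\<^sub>j\<bar> \<le> h\<close>. The increments are independent and centred, so Doob's maximal inequality bounds the expected
maximum of the partial sums by \<open>4h sqrt(T)\<close>, uniformly in the grid, and Fatou's lemma carries this to the limit
(lemma \<open>brownian_quadrature_defect_maximal\<close>). Hence the noise contributes \<open>O(h)\<close> to the expected maximum.

The local errors accumulate through a discrete Gronwall inequality (lemma \<open>theta_splitting_error\<close>). Its constants
involve the path only through \<open>sup \<bar>z\<bar>\<close>, which has finite expectation: by Gronwall it is at most affine
in \<open>\<bar>z(0)\<bar>\<close> and \<open>sup \<bar>W - W(0)\<bar>\<close>, and the latter is integrable by the same maximal inequality with unit weights.
Picard iteration supplies what the solution maps need: they are well defined, and, as limits of
explicit iterates, measurable in the path.\<close>

section \<open>Gronwall inequalities\<close>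

lemma gronwall:
  fixes u :: "real \<Rightarrow> real"
  assumes cont: "continuous_on {s..t} u" and L: "L \<ge> 0"
    and le: "\<And>r. r \<in> {s..t} \<Longrightarrow> u r \<le> A + L * integral {s..r} u"
    and r: "r \<in> {s..t}"
  shows "u r \<le> A * exp (L * (r - s))"
proof -
  define U where "U r = A + L * integral {s..r} u" for r
  \<comment> \<open>The majorant, discounted at rate \<open>L\<close>, is nonincreasing.\<close>
  define \<psi> where "\<psi> q = exp (- L * (q - s)) * U q" for q
  have dU: "(U has_real_derivative L * u q) (at q within {s..t})" if "q \<in> {s..t}" for q
    unfolding U_def has_real_derivative_iff_has_vector_derivative
    using integral_has_vector_derivative[OF cont that]
    by (auto intro!: derivative_eq_intros)
  have d\<psi>: "(\<psi> has_real_derivative exp (- L * (q - s)) * L * (u q - U q)) (at q within {s..t})"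
    if "q \<in> {s..t}" for q
    unfolding \<psi>_def
    by (auto intro!: derivative_eq_intros dU that simp: algebra_simps)
  have "\<psi> r \<le> \<psi> s"
  proof (rule DERIV_nonpos_imp_decreasing_open[where f = \<psi>])
    fix q assume q: "s < q" "q < r"
    then have "(\<psi> has_real_derivative exp (- L * (q - s)) * L * (u q - U q)) (at q)"
      using d\<psi>[of q] r by (simp add: at_within_Icc_at)
    moreover have "exp (- L * (q - s)) * L * (u q - U q) \<le> 0"
      using le[of q] q r L by (intro mult_nonneg_nonpos) (auto simp: U_def)
    ultimately show "\<exists>y. DERIV \<psi> q :> y \<and> y \<le> 0" by blast
  next
    have "continuous_on {s..t} \<psi>"
      by (rule DERIV_continuous_on) (rule d\<psi>)
    then show "continuous_on {s..r} \<psi>"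
      by (rule continuous_on_subset) (use r in auto)
  qed (use r in auto)
  then have "exp (L * (r - s)) * (exp (- L * (r - s)) * U r) \<le> exp (L * (r - s)) * A"
    by (intro mult_left_mono) (auto simp: \<psi>_def U_def)
  moreover have "exp (L * (r - s)) * exp (- L * (r - s)) = 1"
    unfolding exp_add[symmetric] by simp
  ultimately have "U r \<le> exp (L * (r - s)) * A"
    by (simp only: mult.assoc[symmetric] mult_1)
  with le[OF r] show ?thesis by (simp only: U_def mult.commute[of A])
qed

text \<open>The right-hand side itself grows by a factor of at most \<open>1 + q \<le> exp q\<close> per step.\<close>
lemma discrete_gronwall:
  fixes e :: "nat \<Rightarrow> real"
  assumes q: "q \<ge> 0" and c: "c \<ge> 0"
    and le: "\<And>k. k \<le> N \<Longrightarrow> e k \<le> c + q * (\<Sum>j<k. e j)"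
    and k: "k \<le> N"
  shows "e k \<le> c * exp (q * real N)"
proof -
  have S: "c + q * (\<Sum>j<k. e j) \<le> c * (1 + q) ^ k" if "k \<le> N" for k
    using that
  proof (induction k)
    case (Suc k)
    then have "q * e k \<le> q * (c + q * (\<Sum>j<k. e j))"
      using le[of k] q by (intro mult_left_mono) auto
    then have "c + q * (\<Sum>j<Suc k. e j) \<le> (1 + q) * (c + q * (\<Sum>j<k. e j))"
      by (simp add: algebra_simps)
    also have "\<dots> \<le> (1 + q) * (c * (1 + q) ^ k)"
      using Suc q by (intro mult_left_mono) auto
    finally show ?case by (simp add: mult_ac)
  qed simp
  have "e k \<le> c * (1 + q) ^ k" using le[OF k] S[OF k] by simp
  also have "\<dots> \<le> c * (1 + q) ^ N" using q c k by (intro mult_left_mono power_increasing) auto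
  also have "\<dots> \<le> c * exp q ^ N" using q c by (intro mult_left_mono power_mono) auto
  also have "exp q ^ N = exp (q * real N)" by (simp add: exp_of_nat2_mult)
  finally show ?thesis .
qed

section \<open>Integral equations with Lipschitz drift\<close>
lemma solves_integral_eq:
  assumes "solves b N s t z\<^sub>0 z" "r \<in> {s..t}"
  shows "z r = z\<^sub>0 + (N r - N s) + integral {s..r} (\<lambda>q. b (z q))"
  using assms unfolding solves_def has_integral_iff by auto

lemma solvesI:
  assumes "continuous_on {s..t} z" "continuous_on UNIV b"
    and "\<And>r. r \<in> {s..t} \<Longrightarrow> z r = z\<^sub>0 + (N r - N s) + integral {s..r} (\<lambda>q. b (z q))"
  shows "solves b N s t z\<^sub>0 z"
  unfolding solves_def
proof (intro conjI ballI)
  fix r assume r: "r \<in> {s..t}"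
  have "continuous_on {s..t} (\<lambda>q. b (z q))"
    using assms(2,1) by (rule continuous_on_compose2) auto
  then have "(\<lambda>q. b (z q)) integrable_on {s..r}"
    by (intro integrable_continuous_real, rule continuous_on_subset) (use r in auto)
  with assms(3)[OF r] show "((\<lambda>q. b (z q)) has_integral z r - z\<^sub>0 - (N r - N s)) {s..r}"
    by (simp add: has_integral_iff)
qed fact

lemma solves_unique:
  assumes b: "L-lipschitz_on UNIV b"
    and y: "solves b N s t z\<^sub>0 y" and z: "solves b N s t z\<^sub>0 z" and r: "r \<in> {s..t}"
  shows "y r = z r"
proof -
  have cy: "continuous_on {s..t} y" and cz: "continuous_on {s..t} z"
    using y z by (auto simp: solves_def)
  have cb: "continuous_on UNIV b" using b by (rule lipschitz_on_continuous_on)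
  have "norm (y r - z r) \<le> 0 * exp (L * (r - s))"
  proof (rule gronwall[where t = t])
    show "continuous_on {s..t} (\<lambda>r. norm (y r - z r))"
      by (intro continuous_intros cy cz)
    fix r assume r: "r \<in> {s..t}"
    have cy': "continuous_on {s..r} y" and cz': "continuous_on {s..r} z"
      using cy cz r by (auto intro: continuous_on_subset)
    have i: "(\<lambda>q. b (y q)) integrable_on {s..r}" "(\<lambda>q. b (z q)) integrable_on {s..r}"
      by (auto intro!: integrable_continuous_real continuous_on_compose2[OF cb] cy' cz')
    have "norm (y r - z r) = norm (integral {s..r} (\<lambda>q. b (y q) - b (z q)))"
      using solves_integral_eq[OF y r] solves_integral_eq[OF z r] i
      by (simp add: integral_diff)
    also have "\<dots> \<le> integral {s..r} (\<lambda>q. L * norm (y q - z q))"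
      using b by (intro integral_norm_bound_integral integrable_diff i integrable_continuous_real
          continuous_intros cy' cz') (auto simp: lipschitz_on_def dist_norm)
    finally show "norm (y r - z r) \<le> 0 + L * integral {s..r} (\<lambda>q. norm (y q - z q))" by simp
  qed (use b r in \<open>auto simp: lipschitz_on_def\<close>)
  then show ?thesis by simp
qed

text \<open>This a priori bound makes the supremum of a solution integrable as soon as the initial
value and the supremum of the noise are.\<close>
lemma solves_norm_le:
  assumes b: "L-lipschitz_on UNIV b" and z: "solves b N s t z\<^sub>0 z"
    and N: "\<And>r. r \<in> {s..t} \<Longrightarrow> norm (N r - N s) \<le> R" and r: "r \<in> {s..t}"
  shows "norm (z r) \<le> (norm z\<^sub>0 + R + norm (b 0) * (t - s)) * exp (L * (t - s))"
proof -
  have cz: "continuous_on {s..t} z"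
    using z by (auto simp: solves_def)
  have cb: "continuous_on UNIV b" using b by (rule lipschitz_on_continuous_on)
  have L: "L \<ge> 0" using b by (auto simp: lipschitz_on_def)
  have R: "R \<ge> 0" using N[OF r] norm_ge_zero order_trans by blast
  have "norm (z r) \<le> (norm z\<^sub>0 + R + norm (b 0) * (t - s)) * exp (L * (r - s))"
  proof (rule gronwall[where t = t])
    show "continuous_on {s..t} (\<lambda>r. norm (z r))"
      by (intro continuous_intros cz)
    fix r assume r: "r \<in> {s..t}"
    have cz': "continuous_on {s..r} z"
      using cz r by (auto intro: continuous_on_subset)
    have i: "(\<lambda>q. b (z q)) integrable_on {s..r}"
      by (auto intro!: integrable_continuous_real continuous_on_compose2[OF cb] cz')
    have "norm (b x) \<le> norm (b 0) + L * norm x" for x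
      using lipschitz_onD[OF b, of x 0] norm_triangle_sub[of "b x" "b 0"] by (simp add: dist_norm)
    then have "norm (integral {s..r} (\<lambda>q. b (z q))) \<le> integral {s..r} (\<lambda>q. norm (b 0) + L * norm (z q))"
      by (intro integral_norm_bound_integral i integrable_continuous_real continuous_intros cz') auto
    also have "\<dots> = norm (b 0) * (r - s) + L * integral {s..r} (\<lambda>q. norm (z q))"
      using r by (subst integral_add) (auto intro!: integrable_continuous_real continuous_intros cz')
    also have "norm (b 0) * (r - s) \<le> norm (b 0) * (t - s)"
      using r by (intro mult_left_mono) auto
    finally show "norm (z r) \<le> (norm z\<^sub>0 + R + norm (b 0) * (t - s)) + L * integral {s..r} (\<lambda>q. norm (z q))"
      unfolding solves_integral_eq[OF z r]
      using N[OF r] norm_triangle_ineq[of "z\<^sub>0 + (N r - N s)" "integral {s..r} (\<lambda>q. b (z q))"]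
       norm_triangle_ineq[of z\<^sub>0 "N r - N s"]  by linarith
  qed (use b r in \<open>auto simp: lipschitz_on_def\<close>)
  also have "\<dots> \<le> (norm z\<^sub>0 + R + norm (b 0) * (t - s)) * exp (L * (t - s))"
    using r L R by (intro mult_left_mono) (auto intro!: mult_left_mono)
  finally show ?thesis .
qed

text \<open>The iteration is made explicit, rather than hidden in a fixed point theorem, because its iterates depend
measurably on the noise path; the solution map inherits this in the limit.\<close>
primrec picard ::
  "('a::euclidean_space \<Rightarrow> 'a) \<Rightarrow> (real \<Rightarrow> 'a) \<Rightarrow> real \<Rightarrow> 'a \<Rightarrow> nat \<Rightarrow> real \<Rightarrow> 'a" where
  "picard b N s z\<^sub>0 0 r = z\<^sub>0"
| "picard b N s z\<^sub>0 (Suc n) r = z\<^sub>0 + (N r - N s) + integral {s..r} (\<lambda>q. b (picard b N s z\<^sub>0 n q))"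

lemma continuous_on_picard:
  assumes b: "continuous_on UNIV b" and N: "continuous_on {s..t} N"
  shows "continuous_on {s..t} (picard b N s z\<^sub>0 n)"
proof (induction n)
  case (Suc n)
  have "continuous_on {s..t} (\<lambda>r. integral {s..r} (\<lambda>q. b (picard b N s z\<^sub>0 n q)))"
    by (intro indefinite_integral_continuous_1 integrable_continuous_real
        continuous_on_compose2[OF b] Suc) auto
  then show ?case by (auto intro!: continuous_intros N)
qed auto

text \<open>Measured with the weight \<open>exp (2L(r - s))\<close>, one iteration halves distances: integrating \<open>L\<close> times the weight gives
at most half of the weight. This gives convergence on intervals of any length.\<close>
lemma picard_converges:
  assumes b: "L-lipschitz_on UNIV b" and N: "continuous_on {s..t} N" and st: "s \<le> t"
  obtains z where "solves b N s t z\<^sub>0 z" "\<And>r. r \<in> {s..t} \<Longrightarrow> (\<lambda>n. picard b N s z\<^sub>0 n r) \<longlonglongrightarrow> z r"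
proof -
  define p where "p = picard b N s z\<^sub>0"
  have cb: "continuous_on UNIV b" using b by (rule lipschitz_on_continuous_on)
  have L: "L \<ge> 0" using b by (auto simp: lipschitz_on_def)
  have cp: "continuous_on {s..t} (p n)" for n
    unfolding p_def using cb N by (rule continuous_on_picard)
  have "continuous_on {s..t} (\<lambda>r. norm (p 1 r - p 0 r))" by (intro continuous_intros cp)
  then have "\<exists>x\<in>{s..t}. \<forall>r\<in>{s..t}. norm (p 1 r - p 0 r) \<le> norm (p 1 x - p 0 x)"
    using st by (intro continuous_attains_sup) auto
  then obtain C where C: "\<And>r. r \<in> {s..t} \<Longrightarrow> norm (p 1 r - p 0 r) \<le> C" by blast
  have C0: "C \<ge> 0" using C[of s] st norm_ge_zero order_trans by (metis atLeastAtMost_iff order_refl)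
  have step: "norm (p (Suc n) r - p n r) \<le> C * (1/2) ^ n * exp (2 * L * (r - s))" if "r \<in> {s..t}" for n r
    using that
  proof (induction n arbitrary: r)
    case 0
    have "C * 1 \<le> C * exp (2 * L * (r - s))" using C0 L 0 by (intro mult_left_mono) auto
    then show ?case using C[OF 0] by simp
  next
    case (Suc n)
    define K where "K = C * (1/2) ^ n"
    have K: "K \<ge> 0" using C0 by (auto simp: K_def)
    have cp': "continuous_on {s..r} (p n)" for n
      using cp by (rule continuous_on_subset) (use Suc in auto)
    have i: "(\<lambda>q. b (p n q)) integrable_on {s..r}" for n
      by (auto intro!: integrable_continuous_real continuous_on_compose2[OF cb] cp')
    have I: "((\<lambda>q. L * (K * exp (2 * L * (q - s)))) has_integral
          (K / 2 * exp (2 * L * (r - s)) - K / 2 * exp (2 * L * (s - s)))) {s..r}"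
      by (rule fundamental_theorem_of_calculus)
         (use Suc in \<open>auto intro!: derivative_eq_intros simp flip: has_real_derivative_iff_has_vector_derivative\<close>)
    have "norm (p (Suc (Suc n)) r - p (Suc n) r)
        = norm (integral {s..r} (\<lambda>q. b (p (Suc n) q) - b (p n q)))"
      using i by (simp add: integral_diff p_def del: picard.simps)
                 (simp add: integral_diff)
    also have "\<dots> \<le> integral {s..r} (\<lambda>q. L * (K * exp (2 * L * (q - s))))"
    proof (intro integral_norm_bound_integral integrable_diff i)
      fix q assume q: "q \<in> {s..r}"
      have "norm (b (p (Suc n) q) - b (p n q)) \<le> L * norm (p (Suc n) q - p n q)"
        using b by (auto simp: lipschitz_on_def dist_norm)
      also have "\<dots> \<le> L * (K * exp (2 * L * (q - s)))"
        using Suc.IH[of q] q Suc.prems L by (intro mult_left_mono) (auto simp: K_def)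
      finally show "norm (b (p (Suc n) q) - b (p n q)) \<le> L * (K * exp (2 * L * (q - s)))" .
    qed (use I in \<open>auto simp: has_integral_iff\<close>)
    also have "\<dots> \<le> K / 2 * exp (2 * L * (r - s))"
      using I K by (simp add: has_integral_iff)
    finally show ?case by (simp add: K_def)
  qed
  have step': "norm (p (Suc n) r - p n r) \<le> C * exp (2 * L * (t - s)) * (1/2) ^ n" if "r \<in> {s..t}" for n r
  proof -
    have "C * (1/2) ^ n * exp (2 * L * (r - s)) \<le> C * (1/2) ^ n * exp (2 * L * (t - s))"
      using that L C0 by (intro mult_left_mono) (auto intro!: mult_left_mono)
    also have "\<dots> = C * exp (2 * L * (t - s)) * (1/2) ^ n" by (simp only: mult_ac)
    finally show ?thesis using step[OF that, of n] by (rule order_trans[rotated])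
  qed
  have "uniform_limit {s..t} (\<lambda>n r. \<Sum>i<n. p (Suc i) r - p i r) (\<lambda>r. \<Sum>i. p (Suc i) r - p i r) sequentially"
    by (rule Weierstrass_m_test[where M = "\<lambda>n. C * exp (2 * L * (t - s)) * (1/2) ^ n"])
       (use step' in \<open>auto intro!: summable_mult summable_geometric\<close>)
  then have "uniform_limit {s..t} (\<lambda>n r. z\<^sub>0 + (\<Sum>i<n. p (Suc i) r - p i r))
      (\<lambda>r. z\<^sub>0 + (\<Sum>i. p (Suc i) r - p i r)) sequentially"
    by (intro uniform_limit_intros)
  moreover have "z\<^sub>0 + (\<Sum>i<n. p (Suc i) r - p i r) = p n r" for n r
    by (subst sum_lessThan_telescope) (simp add: p_def)
  ultimately obtain z where z: "uniform_limit {s..t} p z sequentially" by auto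
  have cz: "continuous_on {s..t} z"
    by (rule uniform_limit_theorem[OF _ z]) (use cp in auto)
  have pz: "(\<lambda>n. p n r) \<longlonglongrightarrow> z r" if "r \<in> {s..t}" for r
    using tendsto_uniform_limitI[OF z that] .
  show ?thesis
  proof (rule that)
    show "solves b N s t z\<^sub>0 z"
    proof (rule solvesI[OF cz cb])
      fix r assume r: "r \<in> {s..t}"
      have "uniform_limit {s..r} p z sequentially"
        using z by (rule uniform_limit_on_subset) (use r in auto)
      then have ub: "uniform_limit {s..r} (\<lambda>n q. b (p n q)) (\<lambda>q. b (z q)) sequentially"
        by (rule uniform_limit_compose_uniformly_continuous_on)
           (use lipschitz_on_uniformly_continuous[OF b] in auto)
      have "continuous_on {s..r} (\<lambda>q. b (p n q))" for n
        by (rule continuous_on_compose2[OF cb continuous_on_subset[OF cp]]) (use r in auto)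
      from uniform_limit_integral[OF ub this] obtain I J where
        "\<And>n. ((\<lambda>q. b (p n q)) has_integral I n) {s..r}" "((\<lambda>q. b (z q)) has_integral J) {s..r}"
        "I \<longlonglongrightarrow> J" by auto
      then have "(\<lambda>n. integral {s..r} (\<lambda>q. b (p n q))) \<longlonglongrightarrow> integral {s..r} (\<lambda>q. b (z q))"
        by (simp add: has_integral_iff)
      then have "(\<lambda>n. p (Suc n) r) \<longlonglongrightarrow> z\<^sub>0 + (N r - N s) + integral {s..r} (\<lambda>q. b (z q))"
        unfolding p_def picard.simps by (intro tendsto_intros)
      with LIMSEQ_Suc[OF pz[OF r]]
      show "z r = z\<^sub>0 + (N r - N s) + integral {s..r} (\<lambda>q. b (z q))"
        by (rule LIMSEQ_unique)
    qed
  qed (use pz in \<open>auto simp: p_def\<close>)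
qed

lemma solution_map_eq:
  assumes "L-lipschitz_on UNIV b" "solves b N s t z\<^sub>0 z" "s \<le> t"
  shows "solution_map b N s t z\<^sub>0 = z t"
  unfolding solution_map_def
  using assms solves_unique[OF assms(1)] by (intro the_equality) (auto intro!: exI[of _ z])

section \<open>Riemann sums and measurability of the solution map\<close>

text \<open>Riemann sums enter twice: an integral along a random continuous path is measurable as their limit, and they
turn the quadrature error of a Brownian path into a finite combination of independent increments.\<close>
lemma riemann_sum_tendsto:
  fixes g :: "real \<Rightarrow> 'a::euclidean_space"
  assumes g: "continuous_on {a..b} g" and ab: "a \<le> b"
  shows "(\<lambda>m. ((b - a) / real (Suc m)) *\<^sub>R (\<Sum>i<Suc m. g (a + real i * ((b - a) / real (Suc m)))))
           \<longlonglongrightarrow> integral {a..b} g"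
proof -
  have "uniformly_continuous_on {a..b} g"
    using g by (rule compact_uniformly_continuous) auto
  show ?thesis
  proof (rule LIMSEQ_I)
    fix e :: real assume e: "e > 0"
    define e' where "e' = e / (2 * (b - a + 1))"
    have e': "e' > 0" using e ab by (auto simp: e'_def)
    with \<open>uniformly_continuous_on {a..b} g\<close> obtain d where d: "d > 0"
      "\<And>x y. x \<in> {a..b} \<Longrightarrow> y \<in> {a..b} \<Longrightarrow> dist x y < d \<Longrightarrow> dist (g x) (g y) < e'"
      unfolding uniformly_continuous_on_def by metis
    obtain m0 where m0: "(b - a) / d < real m0" using reals_Archimedean2 by blast
    show "\<exists>no. \<forall>m\<ge>no. norm (((b - a) / real (Suc m)) *\<^sub>R
        (\<Sum>i<Suc m. g (a + real i * ((b - a) / real (Suc m)))) - integral {a..b} g) < e"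
    proof (intro exI allI impI)
      fix m assume m: "m \<ge> m0"
      define \<delta> where "\<delta> = (b - a) / real (Suc m)"
      have \<delta>: "\<delta> \<ge> 0" using ab by (auto simp: \<delta>_def)
      have \<delta>d: "\<delta> < d"
      proof -
        have "(b - a) / d < real (Suc m)" using m0 m by linarith
        then show ?thesis using d(1) by (simp add: \<delta>_def field_simps)
      qed
      have top: "a + real (Suc m) * \<delta> = b" by (simp add: \<delta>_def)
      have mon: "a + real i * \<delta> \<le> b" if "i \<le> Suc m" for i
        using that \<delta> mult_right_mono[of "real i" "real (Suc m)" \<delta>] top by linarith
      \<comment> \<open>Over one cell of length \<open>\<delta>\<close> the integrand oscillates by at most \<open>e'\<close>; the cells add up.\<close>
      have "norm (\<delta> *\<^sub>R (\<Sum>i<k. g (a + real i * \<delta>)) - integral {a..a + real k * \<delta>} g) \<le> real k * (\<delta> * e')"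
        if "k \<le> Suc m" for k
        using that
      proof (induction k)
        case (Suc k)
        let ?p = "a + real k * \<delta>" and ?q = "a + real (Suc k) * \<delta>"
        have pq: "a \<le> ?p" "?p \<le> ?q" "?q \<le> b" "?q - ?p = \<delta>"
          using \<delta> mon[of "Suc k"] Suc by (auto simp: algebra_simps)
        have i: "g integrable_on {a..?q}"
          by (intro integrable_continuous_real continuous_on_subset[OF g]) (use pq in auto)
        have c: "continuous_on {?p..?q} g"
          by (rule continuous_on_subset[OF g]) (use pq in auto)
        have "integral {a..?q} g = integral {a..?p} g + integral {?p..?q} g"
          using Henstock_Kurzweil_Integration.integral_combine[OF pq(1,2) i] by simp
        moreover have "\<delta> *\<^sub>R g ?p - integral {?p..?q} g = integral {?p..?q} (\<lambda>x. g ?p - g x)"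
          using pq(2,4) integrable_continuous_real[OF c]
          by (subst integral_diff) auto
        moreover have "norm (integral {?p..?q} (\<lambda>x. g ?p - g x)) \<le> e' * (?q - ?p)"
        proof (rule integral_bound)
          fix x assume x: "x \<in> {?p..?q}"
          then have "dist ?p x < d" using pq \<delta>d by (auto simp: dist_real_def)
          then show "norm (g ?p - g x) \<le> e'"
            using d(2)[of ?p x] x pq(1-3) unfolding dist_norm
            by (meson atLeastAtMost_iff less_imp_le order_trans)
        qed (use pq c in \<open>auto intro!: continuous_intros\<close>)
        moreover have "norm (\<delta> *\<^sub>R (\<Sum>i<k. g (a + real i * \<delta>)) - integral {a..?p} g) \<le> real k * (\<delta> * e')"
          using Suc by simp
        moreover have "\<delta> *\<^sub>R (\<Sum>i<Suc k. g (a + real i * \<delta>)) - (integral {a..?p} g + integral {?p..?q} g)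
          = (\<delta> *\<^sub>R (\<Sum>i<k. g (a + real i * \<delta>)) - integral {a..?p} g) + (\<delta> *\<^sub>R g ?p - integral {?p..?q} g)"
          by (simp add: scaleR_add_right)
        ultimately show ?case
          using norm_triangle_ineq[of "\<delta> *\<^sub>R (\<Sum>i<k. g (a + real i * \<delta>)) - integral {a..?p} g"
              "\<delta> *\<^sub>R g ?p - integral {?p..?q} g"] pq(4)
          by (simp add: algebra_simps)
      qed simp
      moreover have "real (Suc m) * (\<delta> * e') = (b - a) * e'" by (simp add: \<delta>_def)
      ultimately have "norm (\<delta> *\<^sub>R (\<Sum>i<Suc m. g (a + real i * \<delta>)) - integral {a..b} g) \<le> (b - a) * e'"
        using top by (metis order_refl)
      also have "\<dots> < e"
      proof -
        have "(b - a) * e' \<le> (b - a + 1) * e'" using e' by (simp add: algebra_simps)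
        also have "(b - a + 1) * e' = e / 2"
        proof -
          have "c * (e / (2 * c)) = e / 2" if "c > 0" for c :: real using that by simp
          from this[of "b - a + 1"] show ?thesis unfolding e'_def using ab by linarith
        qed
        finally show ?thesis using e by simp
      qed
      finally show "norm (((b - a) / real (Suc m)) *\<^sub>R
        (\<Sum>i<Suc m. g (a + real i * ((b - a) / real (Suc m)))) - integral {a..b} g) < e"
        by (simp add: \<delta>_def)
    qed
  qed
qed

lemma borel_measurable_integral_paths:
  fixes g :: "'w \<Rightarrow> real \<Rightarrow> 'a::euclidean_space"
  assumes "\<And>\<omega>. \<omega> \<in> space M \<Longrightarrow> continuous_on {a..b} (g \<omega>)"
    and "\<And>q. q \<in> {a..b} \<Longrightarrow> (\<lambda>\<omega>. g \<omega> q) \<in> borel_measurable M" and "a \<le> b"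
  shows "(\<lambda>\<omega>. integral {a..b} (g \<omega>)) \<in> borel_measurable M"
proof (rule borel_measurable_LIMSEQ_metric)
  fix \<omega> assume "\<omega> \<in> space M"
  from riemann_sum_tendsto[OF assms(1)[OF this] assms(3)]
  show "(\<lambda>m. ((b - a) / real (Suc m)) *\<^sub>R (\<Sum>i<Suc m. g \<omega> (a + real i * ((b - a) / real (Suc m)))))
           \<longlonglongrightarrow> integral {a..b} (g \<omega>)" .
next
  fix m
  have "a + real i * ((b - a) / real (Suc m)) \<in> {a..b}" if "i < Suc m" for i
  proof -
    have "real i * ((b - a) / real (Suc m)) \<le> real (Suc m) * ((b - a) / real (Suc m))"
      using that assms(3) by (intro mult_right_mono) auto
    then show ?thesis using assms(3) by auto
  qed
  then show "(\<lambda>\<omega>. ((b - a) / real (Suc m)) *\<^sub>R (\<Sum>i<Suc m. g \<omega> (a + real i * ((b - a) / real (Suc m)))))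
      \<in> borel_measurable M"
    by (intro borel_measurable_scaleR borel_measurable_sum assms(2)) auto
qed

lemma borel_measurable_solution_map:
  fixes b :: "'a::euclidean_space \<Rightarrow> 'a"
  assumes b: "L-lipschitz_on UNIV b" and st: "s \<le> t"
    and N: "\<And>\<omega>. \<omega> \<in> space M \<Longrightarrow> continuous_on {s..t} (N \<omega>)"
    and Nm: "\<And>q. q \<in> {s..t} \<Longrightarrow> (\<lambda>\<omega>. N \<omega> q) \<in> borel_measurable M"
    and y: "y \<in> borel_measurable M"
  shows "(\<lambda>\<omega>. solution_map b (N \<omega>) s t (y \<omega>)) \<in> borel_measurable M"
proof (rule borel_measurable_LIMSEQ_metric)
  have cb: "continuous_on UNIV b" using b by (rule lipschitz_on_continuous_on)
  have "(\<lambda>\<omega>. picard b (N \<omega>) s (y \<omega>) n r) \<in> borel_measurable M" if "r \<in> {s..t}" for n r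
    using that
  proof (induction n arbitrary: r)
    case (Suc n)
    have "(\<lambda>\<omega>. integral {s..r} (\<lambda>q. b (picard b (N \<omega>) s (y \<omega>) n q))) \<in> borel_measurable M"
    proof (rule borel_measurable_integral_paths)
      fix \<omega> assume "\<omega> \<in> space M"
      then show "continuous_on {s..r} (\<lambda>q. b (picard b (N \<omega>) s (y \<omega>) n q))"
        by (intro continuous_on_compose2[OF cb continuous_on_subset[OF continuous_on_picard[OF cb N]]])
           (use Suc in auto)
    next
      fix q assume "q \<in> {s..r}"
      then have "(\<lambda>\<omega>. picard b (N \<omega>) s (y \<omega>) n q) \<in> borel_measurable M"
        using Suc by auto
      then show "(\<lambda>\<omega>. b (picard b (N \<omega>) s (y \<omega>) n q)) \<in> borel_measurable M"
        by (rule measurable_compose) (use cb in \<open>rule borel_measurable_continuous_onI\<close>)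
    qed (use Suc in auto)
    then show ?case
      using Suc st unfolding picard.simps
      by (intro borel_measurable_add borel_measurable_diff Nm y) auto
  qed (use y in simp)
  from this[of t] st show "(\<lambda>\<omega>. picard b (N \<omega>) s (y \<omega>) n t) \<in> borel_measurable M" for n by auto
  fix \<omega> assume "\<omega> \<in> space M"
  from picard_converges[OF b N[OF this] st, of "y \<omega>"] obtain z where
    "solves b (N \<omega>) s t (y \<omega>) z" "(\<lambda>n. picard b (N \<omega>) s (y \<omega>) n t) \<longlonglongrightarrow> z t"
    using st by auto
  then show "(\<lambda>n. picard b (N \<omega>) s (y \<omega>) n t) \<longlonglongrightarrow> solution_map b (N \<omega>) s t (y \<omega>)"
    using solution_map_eq[OF b _ st] by metis
qed

section \<open>A maximal inequality for sums of independent centred variables\<close>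
lemma Max_image_atMost_Suc:
  fixes f :: "nat \<Rightarrow> 'a::linorder"
  shows "Max (f ` {..Suc n}) = max (Max (f ` {..n})) (f (Suc n))"
  by (simp add: atMost_Suc max.commute)

lemma tendsto_Max_atMost:
  fixes f :: "'b \<Rightarrow> nat \<Rightarrow> 'a::linorder_topology"
  assumes "\<And>i. i \<le> n \<Longrightarrow> ((\<lambda>m. f m i) \<longlongrightarrow> l i) F"
  shows "((\<lambda>m. Max (f m ` {..n})) \<longlongrightarrow> Max (l ` {..n})) F"
  using assms
proof (induction n)
  case (Suc n)
  then show ?case unfolding Max_image_atMost_Suc by (intro tendsto_max) auto
qed simp

text \<open>The pathwise form of Doob's \<open>L\<^sup>2\<close> inequality. The running maximum \<open>M\<close> changes only when it is attained by
the current sum, so summation by parts gives \<open>M\<^sub>n\<^sup>2 \<le> 2 M\<^sub>n S\<^sub>n - 2 \<Sum> M\<^sub>k x\<^sub>k\<close>, and \<open>2 M\<^sub>n S\<^sub>n \<le> M\<^sub>n\<^sup>2/2 + 2 S\<^sub>n\<^sup>2\<close>. The subtracted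
sum is a martingale transform: it has expectation zero when the \<open>x\<^sub>k\<close> are independent and centred.\<close>
lemma running_max_square_le:
  fixes x :: "nat \<Rightarrow> real"
  defines "S \<equiv> \<lambda>k. \<Sum>j<k. x j"
  shows "(Max (S ` {..n}))\<^sup>2 \<le> 4 * (S n)\<^sup>2 - 4 * (\<Sum>k<n. Max (S ` {..k}) * x k)"
proof -
  let ?M = "\<lambda>k. Max (S ` {..k})"
  have "(?M n)\<^sup>2 \<le> 2 * ?M n * S n - 2 * (\<Sum>k<n. ?M k * x k)"
  proof (induction n)
    case 0
    then show ?case by (simp add: S_def)
  next
    case (Suc n)
    have S: "S (Suc n) = S n + x n" by (simp add: S_def)
    show ?case
    proof (cases "S (Suc n) \<le> ?M n")
      case True
      then have "?M (Suc n) = ?M n" by (simp add: Max_image_atMost_Suc)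
      with Suc S show ?thesis by (simp add: algebra_simps)
    next
      case False
      then have "?M (Suc n) = S (Suc n)" by (simp add: Max_image_atMost_Suc)
      moreover have "2 * (\<Sum>k<Suc n. ?M k * x k) \<le> 2 * ?M n * S (Suc n) - (?M n)\<^sup>2"
        using Suc by (simp add: S algebra_simps)
      moreover have "0 \<le> (S (Suc n) - ?M n)\<^sup>2" by simp
      ultimately show ?thesis by (simp add: power2_eq_square algebra_simps)
    qed
  qed
  \<comment> \<open>Young's inequality for \<open>2 M\<^sub>n S\<^sub>n\<close>.\<close>
  moreover have "0 \<le> (?M n - 2 * S n)\<^sup>2" by simp
  ultimately show ?thesis by (simp add: power2_eq_square algebra_simps)
qed

context prob_space
begin

lemma expectation_le_sqrt:
  fixes Y :: "'a \<Rightarrow> real"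
  assumes "Y \<in> borel_measurable M" "integrable M (\<lambda>\<omega>. (Y \<omega>)\<^sup>2)" "expectation (\<lambda>\<omega>. (Y \<omega>)\<^sup>2) \<le> v"
  shows "integrable M Y" "expectation Y \<le> sqrt v"
proof -
  show i: "integrable M Y" using assms(1,2) by (rule square_integrable_imp_integrable)
  have "0 \<le> variance Y" by (rule variance_positive)
  then have "(expectation Y)\<^sup>2 \<le> v" using variance_eq[OF i assms(2)] assms(3) by simp
  then show "expectation Y \<le> sqrt v" by (rule real_le_rsqrt)
qed

text \<open>Used with \<open>\<phi>\<close> the partial sum and the running maximum of the earlier variables.\<close>
lemma centered_orthogonal_to_past:
  fixes X :: "nat \<Rightarrow> 'a \<Rightarrow> real"
  assumes indep: "indep_vars (\<lambda>_. borel) X {..<n}" and k: "k < n"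
    and \<phi>: "\<phi> \<in> borel_measurable (PiM {..<k} (\<lambda>_. borel))"
    and Y: "\<And>\<omega>. Y \<omega> = \<phi> (restrict (\<lambda>j. X j \<omega>) {..<k})"
    and int: "integrable M Y" "integrable M (X k)" and mean: "expectation (X k) = 0"
  shows "integrable M (\<lambda>\<omega>. Y \<omega> * X k \<omega>)" "expectation (\<lambda>\<omega>. Y \<omega> * X k \<omega>) = 0"
proof -
  have "indep_var borel (\<phi> \<circ> (\<lambda>\<omega>. restrict (\<lambda>j. X j \<omega>) {..<k}))
      borel ((\<lambda>f. f k) \<circ> (\<lambda>\<omega>. restrict (\<lambda>j. X j \<omega>) {k}))"
    using k by (intro indep_var_compose[OF indep_var_restrict[OF indep]] \<phi>) auto
  also have "\<phi> \<circ> (\<lambda>\<omega>. restrict (\<lambda>j. X j \<omega>) {..<k}) = Y" using Y by auto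
  also have "(\<lambda>f. f k) \<circ> (\<lambda>\<omega>. restrict (\<lambda>j. X j \<omega>) {k}) = X k" by auto
  finally have "indep_var borel Y borel (X k)" .
  from indep_var_integrable[OF this int] indep_var_lebesgue_integral[OF this int] mean
  show "integrable M (\<lambda>\<omega>. Y \<omega> * X k \<omega>)" "expectation (\<lambda>\<omega>. Y \<omega> * X k \<omega>) = 0" by auto
qed

lemma doob_maximal:
  fixes X :: "nat \<Rightarrow> 'a \<Rightarrow> real"
  assumes indep: "indep_vars (\<lambda>_. borel) X {..<n}"
    and sq: "\<And>j. j < n \<Longrightarrow> integrable M (\<lambda>\<omega>. (X j \<omega>)\<^sup>2)"
    and mean: "\<And>j. j < n \<Longrightarrow> expectation (X j) = 0"
  defines "Y \<equiv> \<lambda>\<omega>. Max ((\<lambda>k. \<Sum>j<k. X j \<omega>) ` {..n})"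
  shows "Y \<in> borel_measurable M" "integrable M (\<lambda>\<omega>. (Y \<omega>)\<^sup>2)"
    "expectation (\<lambda>\<omega>. (Y \<omega>)\<^sup>2) \<le> 4 * (\<Sum>j<n. expectation (\<lambda>\<omega>. (X j \<omega>)\<^sup>2))"
proof -
  let ?S = "\<lambda>k \<omega>. \<Sum>j<k. X j \<omega>"
  let ?M = "\<lambda>k \<omega>. Max ((\<lambda>k. ?S k \<omega>) ` {..k})"
  have Xm: "X j \<in> borel_measurable M" if "j < n" for j
    using indep that by (auto simp: indep_vars_def)
  have Xi: "integrable M (X j)" if "j < n" for j
    using Xm sq that by (auto intro: square_integrable_imp_integrable)
  have Si: "integrable M (?S k)" if "k \<le> n" for k
    using Xi that by auto
  have Mi: "integrable M (?M k)" if "k \<le> n" for k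
    using that by (induction k) (auto simp del: sum.lessThan_Suc simp: Max_image_atMost_Suc intro!: integrable_max Si)
  have SX: "integrable M (\<lambda>\<omega>. ?S k \<omega> * X k \<omega>)" "expectation (\<lambda>\<omega>. ?S k \<omega> * X k \<omega>) = 0" if "k < n" for k
    by (rule centered_orthogonal_to_past[OF indep that, where \<phi> = "\<lambda>f. \<Sum>j<k. f j" and Y = "?S k"];
        use Si Xi mean that in \<open>auto simp: less_imp_le\<close>)+
  have MX: "integrable M (\<lambda>\<omega>. ?M k \<omega> * X k \<omega>)" "expectation (\<lambda>\<omega>. ?M k \<omega> * X k \<omega>) = 0" if "k < n" for k
  proof -
    have \<phi>: "(\<lambda>f :: nat \<Rightarrow> real. Max ((\<lambda>i. \<Sum>j<i. f j) ` {..k})) \<in> borel_measurable (PiM {..<k} (\<lambda>_. borel))"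
      by (intro borel_measurable_Max borel_measurable_sum measurable_component_singleton) auto
    have eq: "?M k \<omega> = Max ((\<lambda>i. \<Sum>j<i. restrict (\<lambda>j. X j \<omega>) {..<k} j) ` {..k})" for \<omega>
      by (intro arg_cong[where f = Max] image_cong sum.cong) auto
    show "integrable M (\<lambda>\<omega>. ?M k \<omega> * X k \<omega>)" "expectation (\<lambda>\<omega>. ?M k \<omega> * X k \<omega>) = 0"
      using centered_orthogonal_to_past[OF indep that \<phi> eq Mi Xi mean] that by auto
  qed
  have Ssq: "integrable M (\<lambda>\<omega>. (?S k \<omega>)\<^sup>2) \<and>
      expectation (\<lambda>\<omega>. (?S k \<omega>)\<^sup>2) = (\<Sum>j<k. expectation (\<lambda>\<omega>. (X j \<omega>)\<^sup>2))" if "k \<le> n" for k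
    using that
  proof (induction k)
    case (Suc k)
    have "(?S (Suc k) \<omega>)\<^sup>2 = (?S k \<omega>)\<^sup>2 + (2 * (?S k \<omega> * X k \<omega>) + (X k \<omega>)\<^sup>2)" for \<omega>
      by (simp add: power2_eq_square algebra_simps)
    then show ?case using Suc SX[of k] sq[of k] by simp
  qed simp
  show Ym: "Y \<in> borel_measurable M"
    unfolding Y_def by (intro borel_measurable_Max borel_measurable_sum Xm) auto
  have le: "(Y \<omega>)\<^sup>2 \<le> 4 * (?S n \<omega>)\<^sup>2 - 4 * (\<Sum>k<n. ?M k \<omega> * X k \<omega>)" for \<omega>
    unfolding Y_def using running_max_square_le[of "\<lambda>j. X j \<omega>" n] .
  have i1: "integrable M (\<lambda>\<omega>. 4 * (?S n \<omega>)\<^sup>2)" using Ssq[of n] by simp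
  have i2: "integrable M (\<lambda>\<omega>. 4 * (\<Sum>k<n. ?M k \<omega> * X k \<omega>))"
    by (intro integrable_mult_right Bochner_Integration.integrable_sum MX) auto
  note ri = Bochner_Integration.integrable_diff[OF i1 i2]
  show Yi: "integrable M (\<lambda>\<omega>. (Y \<omega>)\<^sup>2)"
    by (rule Bochner_Integration.integrable_bound[OF ri]) (use Ym le in \<open>auto intro!: AE_I2 order_trans[OF le]\<close>)
  have "expectation (\<lambda>\<omega>. (Y \<omega>)\<^sup>2) \<le> expectation (\<lambda>\<omega>. 4 * (?S n \<omega>)\<^sup>2 - 4 * (\<Sum>k<n. ?M k \<omega> * X k \<omega>))"
    by (intro integral_mono Yi ri le)
  also have "\<dots> = 4 * expectation (\<lambda>\<omega>. (?S n \<omega>)\<^sup>2) - 4 * expectation (\<lambda>\<omega>. \<Sum>k<n. ?M k \<omega> * X k \<omega>)"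
    by (simp add: Bochner_Integration.integral_diff[OF i1 i2])
  also have "expectation (\<lambda>\<omega>. \<Sum>k<n. ?M k \<omega> * X k \<omega>) = (\<Sum>k<n. expectation (\<lambda>\<omega>. ?M k \<omega> * X k \<omega>))"
    by (rule Bochner_Integration.integral_sum) (use MX in auto)
  also have "\<dots> = 0" by (intro sum.neutral ballI MX) auto
  finally show "expectation (\<lambda>\<omega>. (Y \<omega>)\<^sup>2) \<le> 4 * (\<Sum>j<n. expectation (\<lambda>\<omega>. (X j \<omega>)\<^sup>2))"
    using Ssq[of n] by simp
qed

text \<open>The maximum of \<open>\<bar>S\<^sub>k\<bar>\<close> is at most the sum of the maxima of \<open>S\<^sub>k\<close> and of \<open>-S\<^sub>k\<close>, both of which are nonnegative
because \<open>S\<^sub>0 = 0\<close>.\<close>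
lemma doob_maximal_abs:
  fixes X :: "nat \<Rightarrow> 'a \<Rightarrow> real"
  assumes indep: "indep_vars (\<lambda>_. borel) X {..<n}"
    and sq: "\<And>j. j < n \<Longrightarrow> integrable M (\<lambda>\<omega>. (X j \<omega>)\<^sup>2)"
    and mean: "\<And>j. j < n \<Longrightarrow> expectation (X j) = 0"
  defines "Y \<equiv> \<lambda>\<omega>. Max ((\<lambda>k. \<bar>\<Sum>j<k. X j \<omega>\<bar>) ` {..n})"
  shows "integrable M Y" "expectation Y \<le> 4 * sqrt (\<Sum>j<n. expectation (\<lambda>\<omega>. (X j \<omega>)\<^sup>2))"
proof -
  let ?V = "\<Sum>j<n. expectation (\<lambda>\<omega>. (X j \<omega>)\<^sup>2)"
  let ?P = "\<lambda>\<omega>. Max ((\<lambda>k. \<Sum>j<k. X j \<omega>) ` {..n})"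
  let ?Q = "\<lambda>\<omega>. Max ((\<lambda>k. \<Sum>j<k. - X j \<omega>) ` {..n})"
  have Xm: "X j \<in> borel_measurable M" if "j < n" for j
    using indep that by (auto simp: indep_vars_def)
  have P: "integrable M ?P" "expectation ?P \<le> sqrt (4 * ?V)"
    using expectation_le_sqrt[OF doob_maximal[OF indep sq mean]] by auto
  have "indep_vars (\<lambda>_. borel) (\<lambda>j \<omega>. - X j \<omega>) {..<n}"
    by (rule indep_vars_compose2[OF indep]) auto
  from expectation_le_sqrt[OF doob_maximal[OF this]] sq mean
  have Q: "integrable M ?Q" "expectation ?Q \<le> sqrt (4 * ?V)" by auto
  have Ym: "Y \<in> borel_measurable M"
    unfolding Y_def by (intro borel_measurable_Max borel_measurable_abs borel_measurable_sum Xm) auto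
  have le: "\<bar>Y \<omega>\<bar> \<le> ?P \<omega> + ?Q \<omega>" for \<omega>
  proof -
    have P: "(\<Sum>j<k. X j \<omega>) \<le> ?P \<omega>" and Q: "(\<Sum>j<k. - X j \<omega>) \<le> ?Q \<omega>" if "k \<le> n" for k
      using that by auto
    have "\<bar>\<Sum>j<k. X j \<omega>\<bar> \<le> ?P \<omega> + ?Q \<omega>" if "k \<le> n" for k
      using P[OF that] Q[OF that] P[of 0] Q[of 0] by (simp add: sum_negf)
    then have "Y \<omega> \<le> ?P \<omega> + ?Q \<omega>" unfolding Y_def by (subst Max_le_iff) auto
    moreover have "0 \<le> Y \<omega>" unfolding Y_def by (subst Max_ge_iff) auto
    ultimately show ?thesis by simp
  qed
  have i: "integrable M (\<lambda>\<omega>. ?P \<omega> + ?Q \<omega>)" using P(1) Q(1) by (rule Bochner_Integration.integrable_add)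
  show Yi: "integrable M Y"
    by (rule Bochner_Integration.integrable_bound[OF i Ym]) (auto intro!: AE_I2 order_trans[OF le])
  have "expectation Y \<le> expectation (\<lambda>\<omega>. ?P \<omega> + ?Q \<omega>)"
    by (intro integral_mono Yi i order_trans[OF abs_ge_self le])
  also have "\<dots> \<le> 4 * sqrt ?V"
    using P Q by (simp add: real_sqrt_mult)
  finally show "expectation Y \<le> 4 * sqrt ?V" .
qed

text \<open>Fatou's lemma in the form that transfers a bound on discretized quantities to their limit.\<close>
lemma expectation_limit_le:
  fixes U :: "nat \<Rightarrow> 'a \<Rightarrow> real"
  assumes int: "\<And>m. integrable M (U m)" and le: "\<And>m. expectation (U m) \<le> c"
    and nonneg: "\<And>m \<omega>. 0 \<le> U m \<omega>" and lim: "\<And>\<omega>. \<omega> \<in> space M \<Longrightarrow> (\<lambda>m. U m \<omega>) \<longlonglongrightarrow> V \<omega>"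
  shows "integrable M V" "expectation V \<le> c"
proof -
  have c: "c \<ge> 0" using order_trans[OF _ le] nonneg by (metis Bochner_Integration.integral_nonneg)
  have V0: "V \<omega> \<ge> 0" if "\<omega> \<in> space M" for \<omega>
    using lim[OF that] nonneg by (intro LIMSEQ_le_const) auto
  have Vm: "V \<in> borel_measurable M"
    using lim borel_measurable_integrable[OF int] by (rule borel_measurable_LIMSEQ_real)
  have "(\<integral>\<^sup>+\<omega>. ennreal (V \<omega>) \<partial>M) = (\<integral>\<^sup>+\<omega>. liminf (\<lambda>m. ennreal (U m \<omega>)) \<partial>M)"
    using lim by (intro nn_integral_cong lim_imp_Liminf[symmetric] tendsto_ennrealI) auto
  also have "\<dots> \<le> liminf (\<lambda>m. \<integral>\<^sup>+\<omega>. ennreal (U m \<omega>) \<partial>M)"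
    using borel_measurable_integrable[OF int] by (intro nn_integral_liminf) auto
  also have "\<dots> = liminf (\<lambda>m. ennreal (expectation (U m)))"
    by (intro arg_cong[where f = liminf] ext nn_integral_eq_integral int) (use nonneg in auto)
  also have "\<dots> \<le> ennreal c"
    using Liminf_mono[of "\<lambda>m. ennreal (expectation (U m))" "\<lambda>_. ennreal c" sequentially] le
    by (auto simp: Liminf_const intro!: always_eventually ennreal_leI)
  finally have nn: "(\<integral>\<^sup>+\<omega>. ennreal (V \<omega>) \<partial>M) \<le> ennreal c" .
  show "integrable M V"
  proof (rule integrableI_nonneg[OF Vm])
    show "(\<integral>\<^sup>+\<omega>. ennreal (V \<omega>) \<partial>M) < \<infinity>" using nn by (rule le_less_trans) auto
  qed (use V0 in auto)
  then show "expectation V \<le> c"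
    using nn V0 c by (simp add: nn_integral_eq_integral)
qed

end

section \<open>Maximal inequalities along Brownian paths\<close>
lemma brownian_increment:
  assumes B: "standard_brownian_motion_1 M B" and st: "0 \<le> s" "s < t"
  shows "integrable M (\<lambda>\<omega>. (B t \<omega> - B s \<omega>)\<^sup>2)" "(\<integral>\<omega>. (B t \<omega> - B s \<omega>) \<partial>M) = 0"
    "(\<integral>\<omega>. (B t \<omega> - B s \<omega>)\<^sup>2 \<partial>M) = t - s"
proof -
  interpret prob_space M using B by (auto simp: standard_brownian_motion_1_def)
  have D: "distributed M lborel (\<lambda>\<omega>. B t \<omega> - B s \<omega>) (normal_density 0 (sqrt (t - s)))"
    using B st by (auto simp: standard_brownian_motion_1_def)
  have pos: "0 < sqrt (t - s)" using st by simp
  show "integrable M (\<lambda>\<omega>. (B t \<omega> - B s \<omega>)\<^sup>2)"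
    using distributed_integrable[OF D, of "\<lambda>x. x\<^sup>2"] integrable_normal_moment[OF pos, of 0 2]
    by (simp add: normal_density_nonneg)
  show mean: "(\<integral>\<omega>. (B t \<omega> - B s \<omega>) \<partial>M) = 0"
    using normal_distributed_expectation[OF pos D] .
  show "(\<integral>\<omega>. (B t \<omega> - B s \<omega>)\<^sup>2 \<partial>M) = t - s"
    using normal_distributed_variance[OF pos D] mean st by simp
qed

text \<open>The bound depends on the grid only through its total length \<open>n\<delta>\<close>; this uniformity is what allows the grid to be refined.\<close>
lemma brownian_weighted_sum_maximal:
  fixes a :: "nat \<Rightarrow> real"
  assumes B: "standard_brownian_motion_1 M B" and \<delta>: "\<delta> > 0" and a: "\<And>j. j < n \<Longrightarrow> \<bar>a j\<bar> \<le> A"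
    and A: "A \<ge> 0"
  defines "Y \<equiv> \<lambda>\<omega>. Max ((\<lambda>k. \<bar>\<Sum>j<k. a j * (B (real (Suc j) * \<delta>) \<omega> - B (real j * \<delta>) \<omega>)\<bar>) ` {..n})"
  shows "integrable M Y" "(\<integral>\<omega>. Y \<omega> \<partial>M) \<le> 4 * A * sqrt (real n * \<delta>)"
proof -
  interpret prob_space M using B by (auto simp: standard_brownian_motion_1_def)
  define X where "X j \<omega> = a j * (B (real (Suc j) * \<delta>) \<omega> - B (real j * \<delta>) \<omega>)" for j \<omega>
  have "mono (\<lambda>j. real j * \<delta>)" using \<delta> by (intro monoI mult_right_mono) auto
  then have "indep_vars (\<lambda>_. borel) (\<lambda>j \<omega>. B (real (Suc j) * \<delta>) \<omega> - B (real j * \<delta>) \<omega>) {..<n}"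
    using B by (auto simp: standard_brownian_motion_1_def dest: spec[of _ "\<lambda>j. real j * \<delta>"])
  then have indep: "indep_vars (\<lambda>_. borel) X {..<n}"
    unfolding X_def by (rule indep_vars_compose2) auto
  have inc: "0 \<le> real j * \<delta>" "real j * \<delta> < real (Suc j) * \<delta>" for j
    using \<delta> by (auto simp: algebra_simps)
  have sq: "integrable M (\<lambda>\<omega>. (X j \<omega>)\<^sup>2)" and mean: "expectation (X j) = 0"
    and var: "expectation (\<lambda>\<omega>. (X j \<omega>)\<^sup>2) = (a j)\<^sup>2 * \<delta>" for j
  proof -
    have "real (Suc j) * \<delta> - real j * \<delta> = \<delta>" by (simp add: algebra_simps)
    note i = brownian_increment[OF B inc[of j], unfolded this]
    show "integrable M (\<lambda>\<omega>. (X j \<omega>)\<^sup>2)" "expectation (\<lambda>\<omega>. (X j \<omega>)\<^sup>2) = (a j)\<^sup>2 * \<delta>"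
      "expectation (X j) = 0"
      unfolding X_def[abs_def] power_mult_distrib using i by (simp_all del: of_nat_Suc)
  qed
  have "(\<Sum>j<n. expectation (\<lambda>\<omega>. (X j \<omega>)\<^sup>2)) \<le> (\<Sum>j<n. A\<^sup>2 * \<delta>)"
    unfolding var using \<delta> a A by (intro sum_mono mult_right_mono) (auto simp flip: abs_le_square_iff)
  then have "4 * sqrt (\<Sum>j<n. expectation (\<lambda>\<omega>. (X j \<omega>)\<^sup>2)) \<le> 4 * sqrt (A\<^sup>2 * (real n * \<delta>))"
    by (simp add: mult_ac)
  also have "\<dots> = 4 * A * sqrt (real n * \<delta>)"
    using A by (simp add: real_sqrt_mult)
  finally show "integrable M Y" "(\<integral>\<omega>. Y \<omega> \<partial>M) \<le> 4 * A * sqrt (real n * \<delta>)"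
    using doob_maximal_abs[OF indep sq mean] unfolding Y_def X_def by auto
qed

lemma grid_max_tendsto:
  fixes g :: "real \<Rightarrow> real"
  assumes g: "continuous_on {0..T} g" and T: "T > 0"
  shows "(\<lambda>m. Max ((\<lambda>i. g (real i * (T / real (Suc m)))) ` {..Suc m})) \<longlonglongrightarrow> Sup (g ` {0..T})"
proof -
  obtain x where x: "x \<in> {0..T}" and max: "\<And>y. y \<in> {0..T} \<Longrightarrow> g y \<le> g x"
    using continuous_attains_sup[OF _ _ g] T by auto
  have "Sup (g ` {0..T}) = g x"
    by (rule cSup_eq_maximum) (use x max in auto)
  \<comment> \<open>\<open>p m\<close> is the last grid point that is not to the right of a maximum point \<open>x\<close>.\<close>
  define p where "p m = real (nat \<lfloor>x * real (Suc m) / T\<rfloor>) * (T / real (Suc m))" for m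
  have fl: "real (nat \<lfloor>x * real (Suc m) / T\<rfloor>) \<le> x * real (Suc m) / T"
    "x * real (Suc m) / T - 1 \<le> real (nat \<lfloor>x * real (Suc m) / T\<rfloor>)" for m
  proof -
    have "0 \<le> x * real (Suc m) / T" using x T by auto
    then show "real (nat \<lfloor>x * real (Suc m) / T\<rfloor>) \<le> x * real (Suc m) / T"
      "x * real (Suc m) / T - 1 \<le> real (nat \<lfloor>x * real (Suc m) / T\<rfloor>)" by linarith+
  qed
  have p: "x - T / real (Suc m) \<le> p m" "p m \<le> x" "0 \<le> p m" for m
    using mult_right_mono[OF fl(1)[of m], of "T / real (Suc m)"]
      mult_right_mono[OF fl(2)[of m], of "T / real (Suc m)"] T
    by (auto simp: p_def left_diff_distrib diff_divide_distrib)
  have "(\<lambda>m. x - T / real (Suc m)) \<longlonglongrightarrow> x - 0"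
    by (intro tendsto_intros LIMSEQ_Suc[OF lim_const_over_n])
  then have "p \<longlonglongrightarrow> x"
    by (intro tendsto_sandwich[of "\<lambda>m. x - T / real (Suc m)" p sequentially "\<lambda>_. x"]) (use p in auto)
  then have "(\<lambda>m. g (p m)) \<longlonglongrightarrow> g x"
    by (rule continuous_on_tendsto_compose[OF g]) (use p x in \<open>auto intro!: always_eventually order_trans[OF p(2)]\<close>)
  moreover have "g (p m) \<le> Max ((\<lambda>i. g (real i * (T / real (Suc m)))) ` {..Suc m})" for m
  proof (rule Max_ge)
    have "x * real (Suc m) / T \<le> T * real (Suc m) / T"
      using x T by (intro divide_right_mono mult_right_mono) auto
    then have "real (nat \<lfloor>x * real (Suc m) / T\<rfloor>) \<le> real (Suc m)"
      using fl(1)[of m] T by simp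
    then show "g (p m) \<in> (\<lambda>i. g (real i * (T / real (Suc m)))) ` {..Suc m}"
      unfolding p_def by (intro imageI) (simp only: of_nat_le_iff atMost_iff)
  qed auto
  moreover have "Max ((\<lambda>i. g (real i * (T / real (Suc m)))) ` {..Suc m}) \<le> g x" for m
  proof (subst Max_le_iff; (intro ballI)?)
    fix y assume "y \<in> (\<lambda>i. g (real i * (T / real (Suc m)))) ` {..Suc m}"
    then obtain i where i: "i \<le> Suc m" "y = g (real i * (T / real (Suc m)))" by auto
    have "real i * (T / real (Suc m)) \<le> real (Suc m) * (T / real (Suc m))"
      using i T by (intro mult_right_mono) auto
    then show "y \<le> g x" unfolding i by (intro max) (use T in auto)
  qed auto
  ultimately have "(\<lambda>m. Max ((\<lambda>i. g (real i * (T / real (Suc m)))) ` {..Suc m})) \<longlonglongrightarrow> g x"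
    using tendsto_sandwich[OF always_eventually always_eventually _ tendsto_const] by meson
  with \<open>Sup (g ` {0..T}) = g x\<close> show ?thesis by (simp only:)
qed

text \<open>With unit weights the partial sums telescope to \<open>B - B(0)\<close> at the grid points.\<close>
lemma brownian_sup_integrable:
  assumes B: "standard_brownian_motion_1 M B" and T: "T > 0"
  shows "integrable M (\<lambda>\<omega>. SUP r\<in>{0..T}. \<bar>B r \<omega> - B 0 \<omega>\<bar>)"
proof -
  interpret prob_space M using B by (auto simp: standard_brownian_motion_1_def)
  define U where "U m \<omega> = Max ((\<lambda>i. \<bar>B (real i * (T / real (Suc m))) \<omega> - B 0 \<omega>\<bar>) ` {..Suc m})" for m \<omega>
  have U: "U m \<omega> = Max ((\<lambda>k. \<bar>\<Sum>j<k. 1 * (B (real (Suc j) * (T / real (Suc m))) \<omega>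
      - B (real j * (T / real (Suc m))) \<omega>)\<bar>) ` {..Suc m})" for m \<omega>
    unfolding U_def mult_1 by (subst sum_lessThan_telescope) simp
  show ?thesis
  proof (rule expectation_limit_le(1))
    fix m
    from brownian_weighted_sum_maximal[OF B, where \<delta> = "T / real (Suc m)" and n = "Suc m" and a = "\<lambda>_. 1" and A = 1] T
    show "integrable M (U m)" "expectation (U m) \<le> 4 * sqrt T"
      unfolding U[abs_def] by (auto simp del: sum.lessThan_Suc)
    show "0 \<le> U m \<omega>" for \<omega>
      unfolding U_def by (subst Max_ge_iff) (auto intro!: bexI[of _ 0])
  next
    fix \<omega> assume "\<omega> \<in> space M"
    then have "continuous_on {0..} (\<lambda>t. B t \<omega>)"
      using B by (auto simp: standard_brownian_motion_1_def)
    then have "continuous_on {0..T} (\<lambda>t. B t \<omega>)" by (rule continuous_on_subset) auto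
    then have "continuous_on {0..T} (\<lambda>r. \<bar>B r \<omega> - B 0 \<omega>\<bar>)" by (intro continuous_intros)
    from grid_max_tendsto[OF this T]
    show "(\<lambda>m. U m \<omega>) \<longlonglongrightarrow> (SUP r\<in>{0..T}. \<bar>B r \<omega> - B 0 \<omega>\<bar>)" unfolding U_def .
  qed
qed

text \<open>The error on the \<open>k\<close>-th step of the quadrature rule that weights the left end point by \<open>1 - \<theta>\<close> and the right end point
by \<open>\<theta>\<close>: the trapezoidal rule for \<open>\<theta> = 1/2\<close>, the right Riemann sum for \<open>\<theta> = 1\<close>.\<close>
definition quadrature_defect :: "real \<Rightarrow> real \<Rightarrow> (real \<Rightarrow> 'a::euclidean_space) \<Rightarrow> nat \<Rightarrow> 'a" where
  "quadrature_defect \<theta> h w k =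
     integral {real k * h..real (Suc k) * h} w
       - h *\<^sub>R ((1 - \<theta>) *\<^sub>R w (real k * h) + \<theta> *\<^sub>R w (real (Suc k) * h))"

text \<open>For \<open>c = (1-\<theta>)p\<close> the right-hand side is, up to the factor of the cell length, the discretized quadrature defect of \<open>u\<close> over \<open>p\<close> cells, and the weights on the left are
of absolute value at most \<open>p\<close> if \<open>0 \<le> \<theta> \<le> 1\<close>.\<close>
lemma summation_by_parts_weights:
  fixes u :: "nat \<Rightarrow> real"
  shows "(\<Sum>j<p. (c - real (Suc j)) * (u (Suc j) - u j)) = (\<Sum>i<p. u i) - (real p - c) * u p - c * u 0"
  by (induction p) (simp_all add: algebra_simps)

text \<open>Each step of length \<open>h\<close> is cut into \<open>m + 1\<close> cells. With the integral replaced by a left Riemann sum over these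
cells, the accumulated defect of the first \<open>K\<close> steps becomes a weighted sum of increments of \<open>w\<close> over the cells. The first \<open>K\<close> steps
consist of the first \<open>K (m + 1)\<close> cells, so the accumulated defects are among the partial sums of one and the same sequence.\<close>
lemma weighted_increments_tendsto_defect:
  fixes w :: "real \<Rightarrow> real"
  assumes w: "continuous_on {0..} w" and h: "h > 0"
  shows "(\<lambda>m. \<Sum>l<K * Suc m. h / real (Suc m) * ((1 - \<theta>) * real (Suc m) - real (Suc (l mod Suc m)))
            * (w (real (Suc l) * (h / real (Suc m))) - w (real l * (h / real (Suc m)))))
         \<longlonglongrightarrow> (\<Sum>k<K. quadrature_defect \<theta> h w k)" (is "?L \<longlonglongrightarrow> _")
proof -
  have L: "?L m = (\<Sum>k<K. (h / real (Suc m)) *\<^sub>R (\<Sum>i<Suc m. w (real k * h + real i * (h / real (Suc m))))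
       - h *\<^sub>R ((1 - \<theta>) *\<^sub>R w (real k * h) + \<theta> *\<^sub>R w (real (Suc k) * h)))" for m
  proof -
    let ?p = "Suc m" and ?\<delta> = "h / real (Suc m)"
    have "(\<Sum>l=k * ?p..<k * ?p + ?p. ?\<delta> * ((1 - \<theta>) * real ?p - real (Suc (l mod ?p)))
            * (w (real (Suc l) * ?\<delta>) - w (real l * ?\<delta>)))
        = ?\<delta> *\<^sub>R (\<Sum>i<?p. w (real k * h + real i * ?\<delta>))
          - h *\<^sub>R ((1 - \<theta>) *\<^sub>R w (real k * h) + \<theta> *\<^sub>R w (real (Suc k) * h))" for k
    proof -
      define u where "u i = w (real k * h + real i * ?\<delta>)" for i
      \<comment> \<open>Cell \<open>j\<close> of step \<open>k\<close> starts at \<open>kh + j\<delta>\<close>.\<close>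
      have pt: "real (k * ?p + j) * ?\<delta> = real k * h + real j * ?\<delta>" for j
      proof -
        have "real ?p * ?\<delta> = h" by simp
        moreover have "real (k * ?p + j) * ?\<delta> = real k * (real ?p * ?\<delta>) + real j * ?\<delta>"
          by (simp only: of_nat_add of_nat_mult distrib_right mult.assoc)
        ultimately show ?thesis by simp
      qed
      have up: "u ?p = w (real (Suc k) * h)"
      proof -
        have "real ?p * ?\<delta> = h" by simp
        moreover have "real (Suc k) * h = real k * h + h" by (simp add: algebra_simps)
        ultimately show ?thesis unfolding u_def by presburger
      qed
      have shift: "(\<Sum>l=k * ?p..<k * ?p + ?p. G l) = (\<Sum>j<?p. G (k * ?p + j))" for G :: "nat \<Rightarrow> real"
        by (subst sum.atLeastLessThan_shift_0) (simp add: atLeast0LessThan comp_def)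
      have "(\<Sum>l=k * ?p..<k * ?p + ?p. ?\<delta> * ((1 - \<theta>) * real ?p - real (Suc (l mod ?p)))
            * (w (real (Suc l) * ?\<delta>) - w (real l * ?\<delta>)))
          = (\<Sum>j<?p. ?\<delta> * ((1 - \<theta>) * real ?p - real (Suc ((k * ?p + j) mod ?p)))
            * (w (real (k * ?p + Suc j) * ?\<delta>) - w (real (k * ?p + j) * ?\<delta>)))"
        by (rule trans[OF shift]) (simp only: add_Suc_right)
      also have "\<dots> = (\<Sum>j<?p. ?\<delta> * (((1 - \<theta>) * real ?p - real (Suc j)) * (u (Suc j) - u j)))"
        unfolding pt u_def by (intro sum.cong refl) (simp del: mult_Suc_right)
      also have "\<dots> = ?\<delta> * ((\<Sum>i<?p. u i) - (real ?p - (1 - \<theta>) * real ?p) * u ?p - (1 - \<theta>) * real ?p * u 0)"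
        unfolding sum_distrib_left[symmetric] summation_by_parts_weights ..
      also have "\<dots> = ?\<delta> * (\<Sum>i<?p. u i) - (real ?p * ?\<delta>) * ((1 - \<theta>) * u 0 + \<theta> * u ?p)"
        by (simp only: algebra_simps)
      also have "real ?p * ?\<delta> = h" by simp
      finally show ?thesis unfolding up unfolding u_def by simp
    qed
    then show ?thesis unfolding sum.nat_group[symmetric] by simp
  qed
  show ?thesis
    unfolding L quadrature_defect_def
  proof (intro tendsto_intros)
    fix k
    have "continuous_on {real k * h..real (Suc k) * h} w"
      using w by (rule continuous_on_subset) (use h in auto)
    moreover have "real k * h \<le> real (Suc k) * h" "real (Suc k) * h - real k * h = h"
      using h by (auto simp: algebra_simps)
    ultimately show "(\<lambda>m. (h / real (Suc m)) *\<^sub>R (\<Sum>i<Suc m. w (real k * h + real i * (h / real (Suc m)))))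
        \<longlonglongrightarrow> integral {real k * h..real (Suc k) * h} w"
      using riemann_sum_tendsto[of "real k * h" "real (Suc k) * h" w] by simp
  qed
qed

text \<open>A single defect has size \<open>h\<^bsup>3/2\<^esup>\<close>, and there are \<open>N\<close> of them; for \<open>Nh = T\<close> the triangle inequality would only give
\<open>O(h\<^bsup>1/2\<^esup>)\<close>. Independence improves this to \<open>O(h)\<close>, which is the source of the order 1.\<close>
lemma brownian_quadrature_defect_maximal:
  fixes N :: nat
  assumes B: "standard_brownian_motion_1 M B" and h: "h > 0" and \<theta>: "0 \<le> \<theta>" "\<theta> \<le> 1"
  defines "Y \<equiv> \<lambda>\<omega>. Max ((\<lambda>K. \<bar>\<Sum>k<K. quadrature_defect \<theta> h (\<lambda>t. B t \<omega>) k\<bar>) ` {..N})"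
  shows "integrable M Y" "(\<integral>\<omega>. Y \<omega> \<partial>M) \<le> 4 * h * sqrt (real N * h)"
proof -
  interpret prob_space M using B by (auto simp: standard_brownian_motion_1_def)
  define S where "S m K \<omega> = (\<Sum>l<K. h / real (Suc m) * ((1 - \<theta>) * real (Suc m) - real (Suc (l mod Suc m)))
            * (B (real (Suc l) * (h / real (Suc m))) \<omega> - B (real l * (h / real (Suc m))) \<omega>))" for m K \<omega>
  define U where "U m \<omega> = Max ((\<lambda>K. \<bar>S m (K * Suc m) \<omega>\<bar>) ` {..N})" for m \<omega>
  have U0: "0 \<le> U m \<omega>" for m \<omega>
    unfolding U_def by (subst Max_ge_iff) auto
  have "integrable M (U m) \<and> expectation (U m) \<le> 4 * h * sqrt (real N * h)" for m
  proof -
    define Z where "Z \<omega> = Max ((\<lambda>k. \<bar>S m k \<omega>\<bar>) ` {..N * Suc m})" for \<omega>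
    have wt: "\<bar>h / real (Suc m) * ((1 - \<theta>) * real (Suc m) - real (Suc (l mod Suc m)))\<bar> \<le> h" for l
    proof -
      have "(1 - \<theta>) * real (Suc m) \<le> 1 * real (Suc m)" "0 \<le> (1 - \<theta>) * real (Suc m)"
        using \<theta> by (auto intro!: mult_right_mono mult_nonneg_nonneg)
      moreover have "real (Suc (l mod Suc m)) \<le> real (Suc m)"
        unfolding of_nat_le_iff by (simp add: Suc_le_eq)
      moreover have "\<bar>c - s\<bar> \<le> p" if "c \<le> 1 * p" "0 \<le> c" "s \<le> p" "0 \<le> s" for c s p :: real
        using that by linarith
      ultimately have "\<bar>(1 - \<theta>) * real (Suc m) - real (Suc (l mod Suc m))\<bar> \<le> real (Suc m)"
        using of_nat_0_le_iff by blast
      then have "h / real (Suc m) * \<bar>(1 - \<theta>) * real (Suc m) - real (Suc (l mod Suc m))\<bar>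
          \<le> h / real (Suc m) * real (Suc m)"
        using h by (intro mult_left_mono) auto
      then show ?thesis using h by (simp add: abs_mult)
    qed
    have Z: "integrable M Z" "expectation Z \<le> 4 * h * sqrt (real N * h)"
    proof -
      have len: "real (N * Suc m) * (h / real (Suc m)) = real N * h"
        unfolding of_nat_mult by (simp del: of_nat_Suc)
      show "integrable M Z" "expectation Z \<le> 4 * h * sqrt (real N * h)"
        using brownian_weighted_sum_maximal[OF B, where \<delta> = "h / real (Suc m)" and n = "N * Suc m" and A = h
            and a = "\<lambda>l. h / real (Suc m) * ((1 - \<theta>) * real (Suc m) - real (Suc (l mod Suc m)))"] wt h
        unfolding Z_def[abs_def] S_def len by simp_all
    qed
    have le: "U m \<omega> \<le> Z \<omega>" for \<omega>
      unfolding U_def Z_def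
    proof (rule Max_mono)
      show "(\<lambda>K. \<bar>S m (K * Suc m) \<omega>\<bar>) ` {..N} \<subseteq> (\<lambda>k. \<bar>S m k \<omega>\<bar>) ` {..N * Suc m}"
        by (auto simp del: mult_Suc_right intro!: imageI)
    qed auto
    have Bm: "B (real l * (h / real (Suc m))) \<in> borel_measurable M" for l
      using B h by (auto simp: standard_brownian_motion_1_def)
    have Um: "U m \<in> borel_measurable M"
      unfolding U_def S_def
      by (intro borel_measurable_Max borel_measurable_abs borel_measurable_sum borel_measurable_times
          borel_measurable_diff Bm) auto
    have Ui: "integrable M (U m)"
      by (rule Bochner_Integration.integrable_bound[OF Z(1) Um])
         (use le U0 in \<open>auto intro!: AE_I2 order_trans[OF le]\<close>)
    moreover have "expectation (U m) \<le> expectation Z" by (intro integral_mono Ui Z le)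
    ultimately show ?thesis using Z by simp
  qed
  moreover have "(\<lambda>m. U m \<omega>) \<longlonglongrightarrow> Y \<omega>" if "\<omega> \<in> space M" for \<omega>
  proof -
    have "continuous_on {0..} (\<lambda>t. B t \<omega>)"
      using B that by (auto simp: standard_brownian_motion_1_def)
    then show ?thesis unfolding U_def Y_def S_def
      by (intro tendsto_Max_atMost tendsto_rabs weighted_increments_tendsto_defect h)
  qed
  ultimately show "integrable M Y" "(\<integral>\<omega>. Y \<omega> \<partial>M) \<le> 4 * h * sqrt (real N * h)"
    using expectation_limit_le[of U "4 * h * sqrt (real N * h)" Y] U0 by auto
qed

section \<open>The Langevin equation and its splitting\<close>
lemma integral_fst_snd:
  assumes "h integrable_on S"
  shows "fst (integral S h) = integral S (\<lambda>q. fst (h q))" "snd (integral S h) = integral S (\<lambda>q. snd (h q))"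
  using integral_linear[OF assms bounded_linear_fst] integral_linear[OF assms bounded_linear_snd]
  by (simp_all add: comp_def)

lemma solves_restart:
  assumes z: "solves b N s t z\<^sub>0 z" and p: "p \<in> {s..t}"
  shows "solves b N p t (z p) z"
  unfolding solves_def
proof (intro conjI ballI)
  show "continuous_on {p..t} z"
    using z p unfolding solves_def by (auto elim: continuous_on_subset)
  fix r assume r: "r \<in> {p..t}"
  have i: "((\<lambda>q. b (z q)) has_integral (z r - z\<^sub>0 - (N r - N s))) {s..r}"
    "((\<lambda>q. b (z q)) has_integral (z p - z\<^sub>0 - (N p - N s))) {s..p}"
    using z p r unfolding solves_def by auto
  then have "integral {s..p} (\<lambda>q. b (z q)) + integral {p..r} (\<lambda>q. b (z q)) = integral {s..r} (\<lambda>q. b (z q))"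
    using p r by (intro Henstock_Kurzweil_Integration.integral_combine) auto
  moreover have "(\<lambda>q. b (z q)) integrable_on {p..r}"
    by (rule integrable_on_subinterval[OF has_integral_integrable[OF i(1)]]) (use p in auto)
  moreover from calculation have "integral {p..r} (\<lambda>q. b (z q))
      = integral {s..r} (\<lambda>q. b (z q)) - integral {s..p} (\<lambda>q. b (z q))"
    by (metis add_diff_cancel_left')
  ultimately show "((\<lambda>q. b (z q)) has_integral (z r - z p - (N r - N p))) {p..r}"
    using i by (simp add: has_integral_iff)
qed

lemma matrix_vector_bound:
  fixes A :: "real ^ 'n ^ 'm"
  obtains B where "B \<ge> 0" "\<And>u. norm (A *v u) \<le> B * norm u"
  using bounded_linear.nonneg_bounded[of "\<lambda>u. A *v u"] by (auto simp: mult.commute)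

lemma langevin_drift_lipschitz:
  fixes f :: "real ^ 'n \<Rightarrow> real ^ 'n"
  assumes L: "L-lipschitz_on UNIV f" and G: "G \<ge> 0" "\<And>u. norm (\<Gamma> *v u) \<le> G * norm u"
  shows "(1 + L + G)-lipschitz_on UNIV (langevin_drift f \<Gamma>)"
proof (rule lipschitz_onI)
  have L0: "L \<ge> 0" using L by (auto simp: lipschitz_on_def)
  then show "0 \<le> 1 + L + G" using G by simp
  fix p q :: "(real ^ 'n) \<times> (real ^ 'n)"
  obtain x v y u where pq: "p = (x, v)" "q = (y, u)" by (cases p, cases q)
  have "langevin_drift f \<Gamma> p - langevin_drift f \<Gamma> q = (v - u, (f x - f y) - \<Gamma> *v (v - u))"
    by (simp add: langevin_drift_def pq matrix_vector_mult_diff_distrib)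
  then have "dist (langevin_drift f \<Gamma> p) (langevin_drift f \<Gamma> q)
      \<le> norm (v - u) + (norm (f x - f y) + norm (\<Gamma> *v (v - u)))"
    unfolding dist_norm
    using norm_Pair_le[of "v - u" "(f x - f y) - \<Gamma> *v (v - u)"]
      norm_triangle_ineq4[of "f x - f y" "\<Gamma> *v (v - u)"] by simp
  also have "\<dots> \<le> norm (v - u) + (L * norm (x - y) + G * norm (v - u))"
    using L G by (intro add_mono order_refl) (auto simp: lipschitz_on_def dist_norm)
  also have "\<dots> \<le> dist p q + (L * dist p q + G * dist p q)"
    using norm_fst_le[of "x - y" "v - u"] norm_snd_le[of "v - u" "x - y"] L0 G
    by (intro add_mono mult_left_mono) (auto simp: pq dist_norm)
  finally show "dist (langevin_drift f \<Gamma> p) (langevin_drift f \<Gamma> q) \<le> (1 + L + G) * dist p q"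
    by (simp add: algebra_simps)
qed

lemma drift_B_lipschitz:
  fixes f :: "real ^ 'n \<Rightarrow> real ^ 'n"
  assumes L: "L-lipschitz_on UNIV f" and G: "G \<ge> 0" "\<And>u. norm (\<Gamma> *v u) \<le> G * norm u"
  shows "(L + G)-lipschitz_on UNIV (drift_B f \<Gamma>)"
proof (rule lipschitz_onI)
  have L0: "L \<ge> 0" using L by (auto simp: lipschitz_on_def)
  then show "0 \<le> L + G" using G by simp
  fix p q :: "(real ^ 'n) \<times> (real ^ 'n)"
  obtain x v y u where pq: "p = (x, v)" "q = (y, u)" by (cases p, cases q)
  have "drift_B f \<Gamma> p - drift_B f \<Gamma> q = (0, (f x - f y) - \<Gamma> *v (v - u))"
    by (simp add: drift_B_def pq matrix_vector_mult_diff_distrib)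
  then have "dist (drift_B f \<Gamma> p) (drift_B f \<Gamma> q) \<le> norm (f x - f y) + norm (\<Gamma> *v (v - u))"
    unfolding dist_norm by (simp add: norm_Pair norm_triangle_ineq4)
  also have "\<dots> \<le> L * norm (x - y) + G * norm (v - u)"
    using L G by (intro add_mono) (auto simp: lipschitz_on_def dist_norm)
  also have "\<dots> \<le> L * dist p q + G * dist p q"
    using norm_fst_le[of "x - y" "v - u"] norm_snd_le[of "v - u" "x - y"] L0 G
    by (intro add_mono mult_left_mono) (auto simp: pq dist_norm)
  finally show "dist (drift_B f \<Gamma> p) (drift_B f \<Gamma> q) \<le> (L + G) * dist p q"
    by (simp add: algebra_simps)
qed

lemma exp_A_eq:
  fixes x v :: "real ^ 'n"
  assumes "a \<ge> 0"
  shows "exp_A a (x, v) = (x + a *\<^sub>R v, v)"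
proof -
  have b: "1-lipschitz_on UNIV (drift_A :: (real ^ 'n) \<times> (real ^ 'n) \<Rightarrow> _)"
    by (rule lipschitz_onI) (auto simp: drift_A_def dist_Pair_Pair)
  have "solves drift_A (\<lambda>_. 0) 0 a (x, v) (\<lambda>r. (x + r *\<^sub>R v, v))"
  proof (rule solvesI)
    fix r assume "r \<in> {0..a}"
    then show "(x + r *\<^sub>R v, v) = (x, v) + (0 - 0) + integral {0..r} (\<lambda>q. drift_A (x + q *\<^sub>R v, v))"
      by (simp add: drift_A_def)
  qed (auto intro!: continuous_intros lipschitz_on_continuous_on[OF b])
  from solution_map_eq[OF b this assms] show ?thesis by (simp add: exp_A_def)
qed

lemma continuous_on_noise:
  "continuous_on S w \<Longrightarrow> continuous_on S (noise \<sigma> w)"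
  unfolding noise_def
  by (intro continuous_intros bounded_linear.continuous_on[OF matrix_vector_mul_bounded_linear])

text \<open>The \<open>B\<close>-flow freezes the position, so the velocity solves a linear equation with constant force \<open>f x\<close>.\<close>
lemma exp_B_path:
  fixes f :: "real ^ 'n \<Rightarrow> real ^ 'n"
  assumes L: "L-lipschitz_on UNIV f" and w: "continuous_on {s..t} w" and st: "s \<le> t"
  obtains u where "exp_B f \<Gamma> \<sigma> w s t (x, v) = (x, u t)" "continuous_on {s..t} u"
    "\<And>r. r \<in> {s..t} \<Longrightarrow> u r = v + \<sigma> *v (w r - w s) + integral {s..r} (\<lambda>q. f x - \<Gamma> *v u q)"
proof -
  obtain G where G: "G \<ge> 0" "\<And>u. norm (\<Gamma> *v u) \<le> G * norm u" using matrix_vector_bound[of \<Gamma>] by blast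
  note b = drift_B_lipschitz[OF L G]
  obtain z where z: "solves (drift_B f \<Gamma>) (noise \<sigma> w) s t (x, v) z"
    using picard_converges[OF b continuous_on_noise[OF w] st] by blast
  have cz: "continuous_on {s..t} z" using z by (simp add: solves_def)
  have int: "(\<lambda>q. drift_B f \<Gamma> (z q)) integrable_on {s..r}" if "r \<in> {s..t}" for r
    using z that by (auto simp: solves_def)
  have fst: "fst (z r) = x" if r: "r \<in> {s..t}" for r
    using arg_cong[OF solves_integral_eq[OF z r], of fst] integral_fst_snd[OF int[OF r]]
    by (simp add: noise_def drift_B_def case_prod_beta)
  have snd: "snd (z r) = v + \<sigma> *v (w r - w s) + integral {s..r} (\<lambda>q. f x - \<Gamma> *v snd (z q))"
    if r: "r \<in> {s..t}" for r
  proof -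
    have "integral {s..r} (\<lambda>q. snd (drift_B f \<Gamma> (z q))) = integral {s..r} (\<lambda>q. f x - \<Gamma> *v snd (z q))"
      using fst r by (intro integral_cong) (auto simp: drift_B_def case_prod_beta)
    then show ?thesis
      using arg_cong[OF solves_integral_eq[OF z r], of snd] integral_fst_snd[OF int[OF r]]
      by (simp add: noise_def matrix_vector_mult_diff_distrib)
  qed
  show ?thesis
  proof (rule that[of "\<lambda>r. snd (z r)"])
    show "exp_B f \<Gamma> \<sigma> w s t (x, v) = (x, snd (z t))"
      unfolding exp_B_def solution_map_eq[OF b z st] using fst[of t] st by (simp add: prod_eq_iff)
  qed (use snd cz in \<open>auto intro!: continuous_intros\<close>)
qed

lemma langevin_path:
  assumes z: "solves (langevin_drift f \<Gamma>) (noise \<sigma> w) 0 T z\<^sub>0 z" and s: "s \<in> {0..T}" "r \<in> {s..T}"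
  shows "fst (z r) = fst (z s) + integral {s..r} (\<lambda>q. snd (z q))"
    "snd (z r) = snd (z s) + \<sigma> *v (w r - w s)
       + integral {s..r} (\<lambda>q. f (fst (z q)) - \<Gamma> *v snd (z q))"
proof -
  note zs = solves_restart[OF z s(1)]
  have "(\<lambda>q. langevin_drift f \<Gamma> (z q)) integrable_on {s..r}"
    using zs s by (auto simp: solves_def)
  note i = integral_fst_snd[OF this]
  show "fst (z r) = fst (z s) + integral {s..r} (\<lambda>q. snd (z q))"
    using arg_cong[OF solves_integral_eq[OF zs s(2)], of fst] i(1)
    by (simp add: noise_def langevin_drift_def case_prod_beta)
  show "snd (z r) = snd (z s) + \<sigma> *v (w r - w s)
       + integral {s..r} (\<lambda>q. f (fst (z q)) - \<Gamma> *v snd (z q))"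
    using arg_cong[OF solves_integral_eq[OF zs s(2)], of snd] i(2)
    by (simp add: noise_def langevin_drift_def case_prod_beta matrix_vector_mult_diff_distrib)
qed

text \<open>A common form of the two methods: \<open>\<theta> = 1/2\<close> is the symmetric and \<open>\<theta> = 1\<close> the non-symmetric splitting.\<close>
primrec theta_splitting ::
  "real \<Rightarrow> (real ^ 'n \<Rightarrow> real ^ 'n) \<Rightarrow> real ^ 'n ^ 'n \<Rightarrow> real ^ 'n ^ 'n \<Rightarrow> (real \<Rightarrow> real ^ 'n)
    \<Rightarrow> (real ^ 'n) \<times> (real ^ 'n) \<Rightarrow> real \<Rightarrow> nat \<Rightarrow> (real ^ 'n) \<times> (real ^ 'n)" where
  "theta_splitting \<theta> f \<Gamma> \<sigma> w z\<^sub>0 h 0 = z\<^sub>0"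
| "theta_splitting \<theta> f \<Gamma> \<sigma> w z\<^sub>0 h (Suc k) =
     (exp_A (\<theta> * h) \<circ> exp_B f \<Gamma> \<sigma> w (real k * h) (real (Suc k) * h) \<circ> exp_A ((1 - \<theta>) * h))
       (theta_splitting \<theta> f \<Gamma> \<sigma> w z\<^sub>0 h k)"

lemma symmetric_splitting_eq_theta:
  "symmetric_splitting f \<Gamma> \<sigma> w z\<^sub>0 h k = theta_splitting (1/2) f \<Gamma> \<sigma> w z\<^sub>0 h k"
  by (induction k) simp_all

lemma nonsymmetric_splitting_eq_theta:
  fixes f :: "real ^ 'n \<Rightarrow> real ^ 'n"
  shows  "nonsymmetric_splitting f \<Gamma> \<sigma> w z\<^sub>0 h k = theta_splitting 1 f \<Gamma> \<sigma> w z\<^sub>0 h k"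
proof (induction k)
  case (Suc k)
  have "exp_A 0 p = p" for p :: "(real ^ 'n) \<times> (real ^ 'n)"
    using exp_A_eq[of 0 "fst p" "snd p"] by simp
  with Suc show ?case by simp
qed simp

section \<open>Pathwise error of the splitting\<close>

text \<open>The error of one step, with \<open>e\<close> the error at its beginning. The equation for \<open>v - u\<close> contains no noise, and its
force term is the difference between the forces at \<open>x r\<close> and at the frozen position, of size \<open>O(e + hZ)\<close>. In the position the quadrature defect of \<open>w\<close> is split off
exactly; it must not be estimated here, since its size \<open>h\<^bsup>3/2\<^esup>\<close> would spoil the order. The remaining
quadrature error is that of \<open>\<xi> = v - \<sigma>w\<close>, which is Lipschitz in time with constant \<open>F\<close>.\<close>
lemma theta_step_error:
  fixes f :: "real ^ 'n \<Rightarrow> real ^ 'n" and x v w u :: "real \<Rightarrow> real ^ 'n"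
  assumes L: "L-lipschitz_on UNIV f" and G: "G \<ge> 0" "\<And>u. norm (\<Gamma> *v u) \<le> G * norm u"
    and h: "0 < h" "h \<le> 1" and \<theta>: "0 \<le> \<theta>" "\<theta> \<le> 1" and t: "t = s + h"
    and cont: "continuous_on {s..t} x" "continuous_on {s..t} v" "continuous_on {s..t} w" "continuous_on {s..t} u"
    and x: "\<And>r. r \<in> {s..t} \<Longrightarrow> x r = x s + integral {s..r} v"
    and v: "\<And>r. r \<in> {s..t} \<Longrightarrow> v r = v s + \<sigma> *v (w r - w s) + integral {s..r} (\<lambda>q. f (x q) - \<Gamma> *v v q)"
    and Z: "\<And>r. r \<in> {s..t} \<Longrightarrow> norm (v r) \<le> Z"
    and F: "\<And>r. r \<in> {s..t} \<Longrightarrow> norm (f (x r) - \<Gamma> *v v r) \<le> F"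
    and u: "\<And>r. r \<in> {s..t} \<Longrightarrow> u r = V + \<sigma> *v (w r - w s)
              + integral {s..r} (\<lambda>q. f (X + ((1 - \<theta>) * h) *\<^sub>R V) - \<Gamma> *v u q)"
  defines "e \<equiv> norm (x s - X) + norm (v s - V)"
    and "K \<equiv> L * (1 + G * exp G) + G * exp G"
  shows "norm ((v t - u t) - (v s - V)) \<le> h * K * (e + 2 * h * Z)"
    "norm ((x t - (X + h *\<^sub>R ((1 - \<theta>) *\<^sub>R V + \<theta> *\<^sub>R u t))) - (x s - X)
        - \<sigma> *v (integral {s..t} w - h *\<^sub>R ((1 - \<theta>) *\<^sub>R w s + \<theta> *\<^sub>R w t)))
      \<le> h * (1 + K) * (e + 2 * h * Z) + h\<^sup>2 * F"
proof -
  define P where "P = X + ((1 - \<theta>) * h) *\<^sub>R V"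
  define b where "b = v s - V"
  define d where "d r = v r - u r" for r
  define q where "q = L * (e + 2 * h * Z)"
  have L0: "L \<ge> 0" using L by (auto simp: lipschitz_on_def)
  have st: "s \<in> {s..t}" "t \<in> {s..t}" "s \<le> t" using h t by auto
  have Z0: "Z \<ge> 0" using Z[OF st(1)] norm_ge_zero order_trans by blast
  have e0: "e \<ge> 0" and be: "norm b \<le> e" by (auto simp: e_def b_def)
  have q0: "q \<ge> 0" using L0 e0 Z0 h by (auto simp: q_def)
  have cf: "continuous_on UNIV f" using L by (rule lipschitz_on_continuous_on)
  have c\<Gamma>: "continuous_on S g \<Longrightarrow> continuous_on S (\<lambda>q. \<Gamma> *v g q)" for S and g :: "real \<Rightarrow> real ^ 'n"
    by (rule bounded_linear.continuous_on[OF matrix_vector_mul_bounded_linear])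
  have c\<sigma>: "continuous_on S g \<Longrightarrow> continuous_on S (\<lambda>q. \<sigma> *v g q)" for S and g :: "real \<Rightarrow> real ^ 'n"
    by (rule bounded_linear.continuous_on[OF matrix_vector_mul_bounded_linear])
  have cfx: "continuous_on {s..t} (\<lambda>q. f (x q))"
    by (rule continuous_on_compose2[OF cf cont(1)]) auto
  have cF: "continuous_on {s..t} (\<lambda>q. f (x q) - \<Gamma> *v v q)"
    and cFP: "continuous_on {s..t} (\<lambda>q. f P - \<Gamma> *v u q)"
    by (intro continuous_intros c\<Gamma> cont cfx)+
  have sub: "continuous_on {s..t} g \<Longrightarrow> continuous_on {a..r} g" if "s \<le> a" "r \<le> t" for a r and g :: "real \<Rightarrow> real ^ 'n"
    by (erule continuous_on_subset) (use that in auto)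
  have tri: "norm (a + b - c + d) \<le> norm a + norm b + norm c + norm d" for a b c d :: "real ^ 'n"
    using norm_triangle_ineq[of "a + b - c" d] norm_triangle_ineq4[of "a + b" c] norm_triangle_ineq[of a b]
    by linarith
  have fP: "norm (f (x r) - f P) \<le> q" if r: "r \<in> {s..t}" for r
  proof -
    have "x r - P = (x s - X) + integral {s..r} v - ((1 - \<theta>) * h) *\<^sub>R v s + ((1 - \<theta>) * h) *\<^sub>R b"
      unfolding x[OF r] P_def b_def by (simp add: algebra_simps)
    then have "norm (x r - P) \<le> norm (x s - X) + norm (integral {s..r} v)
        + norm (((1 - \<theta>) * h) *\<^sub>R v s) + norm (((1 - \<theta>) * h) *\<^sub>R b)"
      by (simp only: tri)
    moreover have "norm (integral {s..r} v) \<le> Z * (r - s)"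
      using r Z by (intro integral_bound sub[OF _ _ cont(2)]) auto
    moreover have "Z * (r - s) \<le> h * Z"
      using mult_left_mono[of "r - s" h Z] Z0 r t by (simp add: mult.commute)
    moreover have c: "0 \<le> (1 - \<theta>) * h" "(1 - \<theta>) * h \<le> h" "(1 - \<theta>) * h \<le> 1"
    proof -
      show "0 \<le> (1 - \<theta>) * h" using \<theta> h by simp
      show "(1 - \<theta>) * h \<le> h" using \<theta> h mult_right_mono[of "1 - \<theta>" 1 h] by simp
      then show "(1 - \<theta>) * h \<le> 1" using h by linarith
    qed
    moreover have "norm (((1 - \<theta>) * h) *\<^sub>R v s) \<le> h * Z"
      unfolding norm_scaleR abs_of_nonneg[OF c(1)] using c Z[OF st(1)] h by (intro mult_mono) auto
    moreover have "norm (((1 - \<theta>) * h) *\<^sub>R b) \<le> norm b"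
      unfolding norm_scaleR abs_of_nonneg[OF c(1)] using mult_right_mono[OF c(3), of "norm b"] by simp
    ultimately have "norm (x r - P) \<le> e + 2 * h * Z" by (simp add: e_def b_def)
    then have "L * norm (x r - P) \<le> q" unfolding q_def using L0 by (rule mult_left_mono)
    then show ?thesis using lipschitz_onD[OF L, of "x r" P] by (simp add: dist_norm)
  qed
  have cd: "continuous_on {s..t} d" unfolding d_def by (intro continuous_intros cont)
  have d: "d r = b + integral {s..r} (\<lambda>q. (f (x q) - f P) - \<Gamma> *v d q)" if r: "r \<in> {s..t}" for r
  proof -
    have i1: "(\<lambda>q. f (x q) - \<Gamma> *v v q) integrable_on {s..r}"
      using r by (intro integrable_continuous_real sub[OF _ _ cF]) auto
    have i2: "(\<lambda>q. f P - \<Gamma> *v u q) integrable_on {s..r}"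
      using r by (intro integrable_continuous_real sub[OF _ _ cFP]) auto
    have "d r = b + (integral {s..r} (\<lambda>q. f (x q) - \<Gamma> *v v q) - integral {s..r} (\<lambda>q. f P - \<Gamma> *v u q))"
      unfolding d_def v[OF r] u[OF r] P_def[symmetric] b_def by simp
    also have "\<dots> = b + integral {s..r} (\<lambda>q. (f (x q) - \<Gamma> *v v q) - (f P - \<Gamma> *v u q))"
      using integral_diff[OF i1 i2] by simp
    finally show ?thesis by (simp add: d_def matrix_vector_mult_diff_distrib algebra_simps)
  qed
  have norm_integrand: "norm ((f (x r) - f P) - \<Gamma> *v d r) \<le> q + G * norm (d r)" if "r \<in> {s..t}" for r
    using fP[OF that] G(2)[of "d r"] norm_triangle_ineq4[of "f (x r) - f P" "\<Gamma> *v d r"] by linarith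
  have cint: "continuous_on {s..t} (\<lambda>q. (f (x q) - f P) - \<Gamma> *v d q)"
    by (intro continuous_intros c\<Gamma> cd cfx)
  have D: "norm (d r) \<le> (e + h * q) * exp G" if r: "r \<in> {s..t}" for r
  proof -
    have "norm (d r) \<le> (e + h * q) * exp (G * (r - s))"
    proof (rule gronwall[where t = t])
      show "continuous_on {s..t} (\<lambda>r. norm (d r))" by (intro continuous_intros cd)
      fix r assume r: "r \<in> {s..t}"
      have cd': "continuous_on {s..r} d" using r by (intro sub[OF _ _ cd]) auto
      have "norm (integral {s..r} (\<lambda>q. (f (x q) - f P) - \<Gamma> *v d q))
          \<le> integral {s..r} (\<lambda>r. q + G * norm (d r))"
        using r by (intro integral_norm_bound_integral integrable_continuous_real sub[OF _ _ cint] continuous_intros cd'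
            norm_integrand) auto
      also have "\<dots> = q * (r - s) + G * integral {s..r} (\<lambda>r. norm (d r))"
        using r by (subst integral_add) (auto intro!: integrable_continuous_real continuous_intros cd')
      also have "q * (r - s) \<le> h * q"
        using mult_left_mono[of "r - s" h q] q0 r t by (simp add: mult.commute)
      finally show "norm (d r) \<le> (e + h * q) + G * integral {s..r} (\<lambda>r. norm (d r))"
        unfolding d[OF r] using be
          norm_triangle_ineq[of b "integral {s..r} (\<lambda>q. (f (x q) - f P) - \<Gamma> *v d q)"] by linarith
    qed (use r G in auto)
    also have "\<dots> \<le> (e + h * q) * exp (G * 1)"
      using r t h G e0 q0 by (intro mult_left_mono iffD2[OF exp_le_cancel_iff]) auto
    finally show ?thesis by simp
  qed
  have "norm (d t - b) \<le> (q + G * ((e + h * q) * exp G)) * (t - s)"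
    unfolding d[OF st(2)] add_diff_cancel_left'
  proof (rule integral_bound[OF st(3) cint])
    fix r assume r: "r \<in> {s..t}"
    show "norm ((f (x r) - f P) - \<Gamma> *v d r) \<le> q + G * ((e + h * q) * exp G)"
      using norm_integrand[OF r] mult_left_mono[OF D[OF r] G(1)] by linarith
  qed
  also have "\<dots> \<le> K * (e + 2 * h * Z) * (t - s)"
  proof (rule mult_right_mono)
    have "G * ((e + h * q) * exp G) \<le> G * ((e + 2 * h * Z + q) * exp G)"
      using h q0 G Z0 mult_right_mono[of h 1 q] by (intro mult_left_mono mult_right_mono add_mono) auto
    then show "q + G * ((e + h * q) * exp G) \<le> K * (e + 2 * h * Z)"
      by (simp add: K_def q_def algebra_simps)
  qed (use st in auto)
  finally have db: "norm (d t - b) \<le> h * K * (e + 2 * h * Z)" by (simp add: t mult_ac)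
  then show "norm ((v t - u t) - (v s - V)) \<le> h * K * (e + 2 * h * Z)" by (simp add: d_def b_def)
  have K0: "K \<ge> 0" using L0 G by (auto simp: K_def)
  have A0: "0 \<le> e + 2 * h * Z" using e0 Z0 h by auto

  \<comment> \<open>The part of the velocity with a Lipschitz path: the noise is subtracted.\<close>
  define \<xi> where "\<xi> r = v r - \<sigma> *v w r" for r
  have c\<xi>: "continuous_on {s..t} \<xi>" unfolding \<xi>_def by (intro continuous_intros c\<sigma> cont)
  have \<xi>: "\<xi> r - \<xi> a = integral {a..r} (\<lambda>q. f (x q) - \<Gamma> *v v q)" if "s \<le> a" "a \<le> r" "r \<le> t" for a r
  proof -
    have ar: "a \<in> {s..t}" "r \<in> {s..t}" using that by auto
    have i: "(\<lambda>q. f (x q) - \<Gamma> *v v q) integrable_on {s..r}"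
      using ar by (intro integrable_continuous_real sub[OF _ _ cF]) auto
    have "\<xi> r - \<xi> a = integral {s..r} (\<lambda>q. f (x q) - \<Gamma> *v v q) - integral {s..a} (\<lambda>q. f (x q) - \<Gamma> *v v q)"
      unfolding \<xi>_def
      by (subst v[OF ar(2)], subst v[OF ar(1)]) (simp add: matrix_vector_mult_diff_distrib algebra_simps)
    also have "integral {s..r} (\<lambda>q. f (x q) - \<Gamma> *v v q)
        = integral {s..a} (\<lambda>q. f (x q) - \<Gamma> *v v q) + integral {a..r} (\<lambda>q. f (x q) - \<Gamma> *v v q)"
      using Henstock_Kurzweil_Integration.integral_combine[OF that(1,2) i] by simp
    finally show ?thesis by simp
  qed
  have F0: "F \<ge> 0" using F[OF st(1)] norm_ge_zero order_trans by blast
  have \<xi>F: "norm (\<xi> r - \<xi> a) \<le> h * F" if "s \<le> a" "a \<le> r" "r \<le> t" for a r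
  proof -
    have "norm (\<xi> r - \<xi> a) \<le> F * (r - a)" unfolding \<xi>[OF that]
      using that F by (intro integral_bound sub[OF _ _ cF]) auto
    also have "\<dots> \<le> F * h" using F0 that t by (intro mult_left_mono) auto
    finally show ?thesis by (simp add: mult.commute)
  qed
  have quad: "norm (integral {s..t} \<xi> - h *\<^sub>R ((1 - \<theta>) *\<^sub>R \<xi> s + \<theta> *\<^sub>R \<xi> t)) \<le> h\<^sup>2 * F"
  proof -
    have "integral {s..t} \<xi> - h *\<^sub>R ((1 - \<theta>) *\<^sub>R \<xi> s + \<theta> *\<^sub>R \<xi> t)
        = integral {s..t} (\<lambda>r. \<xi> r - ((1 - \<theta>) *\<^sub>R \<xi> s + \<theta> *\<^sub>R \<xi> t))"
      using h by (subst integral_diff[OF integrable_continuous_real[OF c\<xi>]]) (auto simp: t)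
    also have "norm \<dots> \<le> (h * F) * (t - s)"
    proof (rule integral_bound[OF st(3)])
      show "continuous_on {s..t} (\<lambda>r. \<xi> r - ((1 - \<theta>) *\<^sub>R \<xi> s + \<theta> *\<^sub>R \<xi> t))"
        by (intro continuous_intros c\<xi>)
      fix r assume r: "r \<in> {s..t}"
      have "\<xi> r - ((1 - \<theta>) *\<^sub>R \<xi> s + \<theta> *\<^sub>R \<xi> t) = (1 - \<theta>) *\<^sub>R (\<xi> r - \<xi> s) + \<theta> *\<^sub>R (\<xi> r - \<xi> t)"
        by (simp add: algebra_simps)
      also have "norm \<dots> \<le> (1 - \<theta>) * norm (\<xi> r - \<xi> s) + \<theta> * norm (\<xi> r - \<xi> t)"
        using \<theta> by (intro order_trans[OF norm_triangle_ineq]) simp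
      also have "\<dots> \<le> (1 - \<theta>) * (h * F) + \<theta> * (h * F)"
        using \<theta> \<xi>F[of s r] \<xi>F[of r t] r st by (intro add_mono mult_left_mono) (auto simp: norm_minus_commute)
      finally show "norm (\<xi> r - ((1 - \<theta>) *\<^sub>R \<xi> s + \<theta> *\<^sub>R \<xi> t)) \<le> h * F" by (simp add: algebra_simps)
    qed
    finally show ?thesis by (simp add: t power2_eq_square mult_ac)
  qed
  have int\<xi>: "integral {s..t} \<xi> = integral {s..t} v - \<sigma> *v integral {s..t} w"
  proof -
    have "integral {s..t} (\<lambda>r. \<sigma> *v w r) = \<sigma> *v integral {s..t} w"
      using integral_linear[OF integrable_continuous_real[OF cont(3)], of "\<lambda>y. \<sigma> *v y"]
      by (simp add: comp_def)
    moreover have "integral {s..t} \<xi> = integral {s..t} v - integral {s..t} (\<lambda>r. \<sigma> *v w r)"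
      unfolding \<xi>_def
      by (rule integral_diff[OF integrable_continuous_real[OF cont(2)]
            integrable_continuous_real[OF c\<sigma>[OF cont(3)]]])
    ultimately show ?thesis by simp
  qed
  \<comment> \<open>Splits the position error into the quadrature error of \<open>\<xi>\<close> and the transported velocity errors.\<close>
  have alg: "((x\<^sub>0 + I) - (X + h *\<^sub>R ((1 - \<theta>) *\<^sub>R V + \<theta> *\<^sub>R U))) - (x\<^sub>0 - X)
        - (J - h *\<^sub>R ((1 - \<theta>) *\<^sub>R p + \<theta> *\<^sub>R q))
      = (I - J - h *\<^sub>R ((1 - \<theta>) *\<^sub>R (v\<^sub>0 - p) + \<theta> *\<^sub>R (v\<^sub>1 - q)))
        + h *\<^sub>R ((1 - \<theta>) *\<^sub>R (v\<^sub>0 - V) + \<theta> *\<^sub>R (v\<^sub>1 - U))"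
    for x\<^sub>0 I U J p q v\<^sub>0 v\<^sub>1 :: "real ^ 'n"
    by (simp add: algebra_simps)
  have "(x t - (X + h *\<^sub>R ((1 - \<theta>) *\<^sub>R V + \<theta> *\<^sub>R u t))) - (x s - X)
        - \<sigma> *v (integral {s..t} w - h *\<^sub>R ((1 - \<theta>) *\<^sub>R w s + \<theta> *\<^sub>R w t))
      = (integral {s..t} \<xi> - h *\<^sub>R ((1 - \<theta>) *\<^sub>R \<xi> s + \<theta> *\<^sub>R \<xi> t)) + h *\<^sub>R ((1 - \<theta>) *\<^sub>R b + \<theta> *\<^sub>R d t)"
    unfolding int\<xi> \<xi>_def b_def d_def x[OF st(2)] matrix_vector_mult_diff_distrib
      matrix_vector_right_distrib matrix_vector_mult_scaleR
    by (rule alg)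
  also have "norm \<dots> \<le> h\<^sup>2 * F + h * ((1 + K) * (e + 2 * h * Z))"
  proof (intro order_trans[OF norm_triangle_ineq] add_mono quad)
    have bA: "norm b \<le> e + 2 * h * Z" using be mult_nonneg_nonneg[of h Z] h Z0 by linarith
    have "norm (d t) \<le> norm b + norm (d t - b)" by (rule norm_triangle_sub)
    also have "\<dots> \<le> norm b + 1 * (K * (e + 2 * h * Z))"
      using db h K0 A0 mult_right_mono[of h 1 "K * (e + 2 * h * Z)"] by (auto simp: mult_ac)
    finally have dt: "norm (d t) \<le> (1 + K) * (e + 2 * h * Z)"
      using bA unfolding distrib_right mult_1 by linarith
    have bt: "norm b \<le> (1 + K) * (e + 2 * h * Z)"
      using bA mult_nonneg_nonneg[OF K0 A0] unfolding distrib_right mult_1 by linarith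
    have "norm ((1 - \<theta>) *\<^sub>R b + \<theta> *\<^sub>R d t) \<le> (1 - \<theta>) * norm b + \<theta> * norm (d t)"
      using \<theta> by (intro order_trans[OF norm_triangle_ineq]) simp
    also have "\<dots> \<le> (1 - \<theta>) * ((1 + K) * (e + 2 * h * Z)) + \<theta> * ((1 + K) * (e + 2 * h * Z))"
      using \<theta> bt dt by (intro add_mono mult_left_mono) auto
    finally have "norm ((1 - \<theta>) *\<^sub>R b + \<theta> *\<^sub>R d t) \<le> (1 + K) * (e + 2 * h * Z)"
      by (simp only: distrib_right[symmetric]) simp
    then show "norm (h *\<^sub>R ((1 - \<theta>) *\<^sub>R b + \<theta> *\<^sub>R d t)) \<le> h * ((1 + K) * (e + 2 * h * Z))"
      using h by simp
  qed
  finally show "norm ((x t - (X + h *\<^sub>R ((1 - \<theta>) *\<^sub>R V + \<theta> *\<^sub>R u t))) - (x s - X)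
        - \<sigma> *v (integral {s..t} w - h *\<^sub>R ((1 - \<theta>) *\<^sub>R w s + \<theta> *\<^sub>R w t)))
      \<le> h * (1 + K) * (e + 2 * h * Z) + h\<^sup>2 * F" by (simp add: mult.assoc)
qed

text \<open>The position error minus the accumulated noise defects has increments of order \<open>he + h\<^sup>2\<close>, so it can be summed in norm;
the defects enter Gronwall's inequality only through the maximum \<open>R\<close> of the norms of their partial sums.\<close>
lemma theta_splitting_error:
  fixes f :: "real ^ 'n \<Rightarrow> real ^ 'n"
  assumes L: "L-lipschitz_on UNIV f" and G: "G \<ge> 0" "\<And>u. norm (\<Gamma> *v u) \<le> G * norm u"
    and h: "0 < h" "h \<le> 1" and \<theta>: "0 \<le> \<theta>" "\<theta> \<le> 1" and N: "real N * h = T"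
    and w: "continuous_on {0..} w"
    and z: "solves (langevin_drift f \<Gamma>) (noise \<sigma> w) 0 T (z 0) z"
    and Z: "\<And>r. r \<in> {0..T} \<Longrightarrow> norm (z r) \<le> Z"
    and R: "\<And>k. k \<le> N \<Longrightarrow> norm (\<sigma> *v (\<Sum>j<k. quadrature_defect \<theta> h w j)) \<le> R"
    and k: "k \<le> N"
  defines "K \<equiv> 1 + 2 * (L * (1 + G * exp G) + G * exp G)"
  shows "norm (z (real k * h) - theta_splitting \<theta> f \<Gamma> \<sigma> w (z 0) h k)
      \<le> (R + T * h * ((2 * K + norm (f 0) + L + G) * (1 + Z))) * exp (K * T)"
proof -
  define K' where "K' = L * (1 + G * exp G) + G * exp G"
  define F where "F = norm (f 0) + (L + G) * Z"
  define Y where "Y = theta_splitting \<theta> f \<Gamma> \<sigma> w (z 0) h"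
  define a where "a k = fst (z (real k * h)) - fst (Y k)" for k
  define b where "b k = snd (z (real k * h)) - snd (Y k)" for k
  define e where "e k = norm (a k) + norm (b k)" for k
  define q where "q = quadrature_defect \<theta> h w"
  have L0: "L \<ge> 0" using L by (auto simp: lipschitz_on_def)
  have T0: "T \<ge> 0" using N h by auto
  have Z0: "Z \<ge> 0" using Z[of 0] T0 norm_ge_zero order_trans by (metis atLeastAtMost_iff order_refl)
  have R0: "R \<ge> 0" using R[of 0] norm_ge_zero order_trans by (metis le0)
  have K'0: "K' \<ge> 0" using L0 G by (auto simp: K'_def)
  have K: "K = 1 + 2 * K'" by (simp add: K_def K'_def)
  have K0: "K \<ge> 0" using K K'0 by simp
  have F0: "F \<ge> 0" using L0 G Z0 by (auto simp: F_def)
  have cz: "continuous_on {0..T} z" using z by (simp add: solves_def)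
  have step: "norm (b (Suc k) - b k) + norm (a (Suc k) - a k - \<sigma> *v q k) \<le> h * K * e k + h\<^sup>2 * (2 * K * Z + F)"
    if k: "k < N" for k
  proof -
    let ?s = "real k * h" and ?t = "real (Suc k) * h"
    define X where "X = fst (Y k)"
    define V where "V = snd (Y k)"
    have t: "?t = ?s + h" by (simp add: algebra_simps)
    have "?t \<le> real N * h" using k h by (intro mult_right_mono) auto
    then have tT: "?t \<le> T" using N by simp
    have s0: "0 \<le> ?s" using h by simp
    have st: "?s \<le> ?t" using h t by simp
    have sub: "r \<in> {0..T}" if "r \<in> {?s..?t}" for r using that s0 tT by auto
    have cw: "continuous_on {?s..?t} w" using w by (rule continuous_on_subset) (use s0 in auto)
    have cz': "continuous_on {?s..?t} z" using cz by (rule continuous_on_subset) (use sub in auto)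
    obtain u where u: "exp_B f \<Gamma> \<sigma> w ?s ?t (X + ((1 - \<theta>) * h) *\<^sub>R V, V) = (X + ((1 - \<theta>) * h) *\<^sub>R V, u ?t)"
      "continuous_on {?s..?t} u"
      "\<And>r. r \<in> {?s..?t} \<Longrightarrow> u r = V + \<sigma> *v (w r - w ?s)
          + integral {?s..r} (\<lambda>q. f (X + ((1 - \<theta>) * h) *\<^sub>R V) - \<Gamma> *v u q)"
      using exp_B_path[OF L cw st] by blast
    have Y: "Y (Suc k) = (X + h *\<^sub>R ((1 - \<theta>) *\<^sub>R V + \<theta> *\<^sub>R u ?t), u ?t)"
    proof -
      have "Y k = (X, V)" by (simp add: X_def V_def)
      then have "Y (Suc k) = exp_A (\<theta> * h) (exp_B f \<Gamma> \<sigma> w ?s ?t (exp_A ((1 - \<theta>) * h) (X, V)))"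
        by (simp add: Y_def)
      then show ?thesis
        using h \<theta> u(1) by (simp add: exp_A_eq algebra_simps)
    qed
    have fst_step: "fst (z r) = fst (z ?s) + integral {?s..r} (\<lambda>q. snd (z q))"
      and snd_step: "snd (z r) = snd (z ?s) + \<sigma> *v (w r - w ?s)
          + integral {?s..r} (\<lambda>q. f (fst (z q)) - \<Gamma> *v snd (z q))" if "r \<in> {?s..?t}" for r
      using langevin_path[OF z, of ?s r] that s0 tT by auto
    have sndZ: "norm (snd (z r)) \<le> Z" if "r \<in> {?s..?t}" for r
      using Z[OF sub[OF that]] norm_snd_le[of "snd (z r)" "fst (z r)"] by simp
    have fstZ: "norm (fst (z r)) \<le> Z" if "r \<in> {?s..?t}" for r
      using Z[OF sub[OF that]] norm_fst_le[of "fst (z r)" "snd (z r)"] by simp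
    have FZ: "norm (f (fst (z r)) - \<Gamma> *v snd (z r)) \<le> F" if r: "r \<in> {?s..?t}" for r
    proof -
      have "norm (f (fst (z r))) \<le> norm (f 0) + L * norm (fst (z r))"
        using lipschitz_onD[OF L, of "fst (z r)" 0] norm_triangle_sub[of "f (fst (z r))" "f 0"]
        by (simp add: dist_norm)
      moreover have "L * norm (fst (z r)) \<le> L * Z" "G * norm (snd (z r)) \<le> G * Z"
        using fstZ[OF r] sndZ[OF r] L0 G(1) by (auto intro: mult_left_mono)
      ultimately show ?thesis
        using norm_triangle_ineq4[of "f (fst (z r))" "\<Gamma> *v snd (z r)"] G(2)[of "snd (z r)"]
        unfolding F_def distrib_right by linarith
    qed
    note E = theta_step_error[OF L G h \<theta> t continuous_on_fst[OF cz'] continuous_on_snd[OF cz'] cw u(2)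
        fst_step snd_step sndZ FZ u(3)]
    have "norm (b (Suc k) - b k) \<le> h * K' * (e k + 2 * h * Z)"
      using E(1) by (simp add: a_def b_def e_def Y X_def V_def K'_def del: of_nat_Suc)
    moreover have "norm (a (Suc k) - a k - \<sigma> *v q k) \<le> h * (1 + K') * (e k + 2 * h * Z) + h\<^sup>2 * F"
      using E(2) by (simp add: a_def b_def e_def Y X_def V_def K'_def q_def quadrature_defect_def del: of_nat_Suc)
    ultimately have "norm (b (Suc k) - b k) + norm (a (Suc k) - a k - \<sigma> *v q k)
        \<le> h * K' * (e k + 2 * h * Z) + (h * (1 + K') * (e k + 2 * h * Z) + h\<^sup>2 * F)" by (rule add_mono)
    also have "\<dots> = h * K * e k + h\<^sup>2 * (2 * K * Z + F)"
      by (simp add: K power2_eq_square algebra_simps)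
    finally show ?thesis .
  qed
  \<comment> \<open>Summation of the local errors; the noise defects stay inside the norm.\<close>
  have sum: "norm (b k) + norm (a k - \<sigma> *v (\<Sum>j<k. q j)) \<le> h * K * (\<Sum>j<k. e j) + real k * (h\<^sup>2 * (2 * K * Z + F))"
    if "k \<le> N" for k
    using that
  proof (induction k)
    case 0
    then show ?case by (simp add: a_def b_def Y_def)
  next
    case (Suc k)
    have eq: "a (Suc k) - \<sigma> *v (\<Sum>j<Suc k. q j)
        = (a k - \<sigma> *v (\<Sum>j<k. q j)) + (a (Suc k) - a k - \<sigma> *v q k)"
      by (simp add: matrix_vector_right_distrib)
    have "norm (b (Suc k)) \<le> norm (b k) + norm (b (Suc k) - b k)" by (rule norm_triangle_sub)
    moreover have "norm (a (Suc k) - \<sigma> *v (\<Sum>j<Suc k. q j))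
        \<le> norm (a k - \<sigma> *v (\<Sum>j<k. q j)) + norm (a (Suc k) - a k - \<sigma> *v q k)"
      unfolding eq by (rule norm_triangle_ineq)
    moreover note step[of k] Suc
    ultimately have "norm (b (Suc k)) + norm (a (Suc k) - \<sigma> *v (\<Sum>j<Suc k. q j))
        \<le> (h * K * (\<Sum>j<k. e j) + real k * (h\<^sup>2 * (2 * K * Z + F))) + (h * K * e k + h\<^sup>2 * (2 * K * Z + F))"
      by linarith
    then show ?case by (simp add: distrib_left distrib_right)
  qed
  have "e k \<le> (R + T * h * (2 * K * Z + F)) * exp (h * K * real N)"
  proof (rule discrete_gronwall[OF _ _ _ k])
    fix k assume k: "k \<le> N"
    have "norm (a k) \<le> norm (\<sigma> *v (\<Sum>j<k. q j)) + norm (a k - \<sigma> *v (\<Sum>j<k. q j))"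
      by (rule norm_triangle_sub)
    moreover have "norm (\<sigma> *v (\<Sum>j<k. q j)) \<le> R" using R[OF k] by (simp add: q_def)
    moreover have "real k * (h\<^sup>2 * (2 * K * Z + F)) \<le> real N * (h\<^sup>2 * (2 * K * Z + F))"
      using k h K0 Z0 F0 by (intro mult_right_mono) auto
    moreover have "real N * (h\<^sup>2 * (2 * K * Z + F)) = T * h * (2 * K * Z + F)"
      by (simp add: N[symmetric] power2_eq_square mult_ac)
    ultimately show "e k \<le> (R + T * h * (2 * K * Z + F)) + h * K * (\<Sum>j<k. e j)"
      using sum[OF k] unfolding e_def by linarith
  qed (use R0 T0 h K0 Z0 F0 in auto)
  also have "h * K * real N = K * T" by (simp add: N[symmetric] mult_ac)
  also have "(R + T * h * (2 * K * Z + F)) * exp (K * T)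
      \<le> (R + T * h * ((2 * K + norm (f 0) + L + G) * (1 + Z))) * exp (K * T)"
  proof (intro mult_right_mono add_mono order_refl mult_left_mono)
    have "0 \<le> 2 * K + norm (f 0) * Z + L + G" using K0 Z0 L0 G by auto
    then show "2 * K * Z + F \<le> (2 * K + norm (f 0) + L + G) * (1 + Z)"
      by (simp add: F_def algebra_simps)
  qed (use T0 h in auto)
  finally have "e k \<le> (R + T * h * ((2 * K + norm (f 0) + L + G) * (1 + Z))) * exp (K * T)" .
  moreover have "norm (z (real k * h) - Y k) \<le> e k"
    using norm_Pair_le[of "a k" "b k"] by (simp add: a_def b_def e_def flip: fst_diff snd_diff)
  ultimately show ?thesis by (simp add: Y_def)
qed

section \<open>Strong order of the splitting methods\<close>
lemma brownian_continuous:
  assumes "standard_brownian_motion M W" "\<omega> \<in> space M"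
  shows "continuous_on {0..} (\<lambda>t. W t \<omega>)"
proof -
  have "continuous_on {0..} (\<lambda>t. \<chi> i. W t \<omega> $ i)"
    using assms by (intro continuous_on_vec_lambda)
      (auto simp: standard_brownian_motion_def standard_brownian_motion_1_def)
  then show ?thesis by simp
qed

lemma brownian_measurable:
  assumes "standard_brownian_motion M W" "t \<ge> 0"
  shows "W t \<in> borel_measurable M"
proof -
  have "(\<lambda>\<omega>. W t \<omega> $ i) \<in> borel_measurable M" for i
    using assms by (auto simp: standard_brownian_motion_def standard_brownian_motion_1_def)
  then show ?thesis
    by (subst borel_measurable_euclidean_space) (auto simp: Basis_vec_def inner_axis)
qed

lemma theta_splitting_measurable:
  fixes f :: "real ^ 'n \<Rightarrow> real ^ 'n"
  assumes W: "standard_brownian_motion M W" and L: "L-lipschitz_on UNIV f"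
    and h: "h > 0" and \<theta>: "0 \<le> \<theta>" "\<theta> \<le> 1" and z: "z \<in> borel_measurable M"
  shows "(\<lambda>\<omega>. theta_splitting \<theta> f \<Gamma> \<sigma> (\<lambda>t. W t \<omega>) (z \<omega>) h k) \<in> borel_measurable M"
proof (induction k)
  case (Suc k)
  obtain G where G: "G \<ge> 0" "\<And>u. norm (\<Gamma> *v u) \<le> G * norm u"
    using matrix_vector_bound[of \<Gamma>] by blast
  let ?s = "real k * h" and ?t = "real (Suc k) * h"
  have st: "0 \<le> ?s" "?s \<le> ?t" using h by (auto intro!: mult_right_mono)
  have A: "(\<lambda>\<omega>. exp_A c (g \<omega>)) \<in> borel_measurable M"
    if c: "c \<ge> 0" and g: "g \<in> borel_measurable M" for c and g :: "_ \<Rightarrow> (real ^ 'n) \<times> (real ^ 'n)"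
  proof -
    have "exp_A c = (\<lambda>p :: (real ^ 'n) \<times> (real ^ 'n). (fst p + c *\<^sub>R snd p, snd p))"
      using exp_A_eq[OF c] by (metis prod.collapse)
    then have "exp_A c \<in> borel_measurable (borel :: ((real ^ 'n) \<times> (real ^ 'n)) measure)"
      by (auto intro!: borel_measurable_continuous_onI continuous_intros)
    then show ?thesis using g by (rule measurable_compose[rotated])
  qed
  have B: "(\<lambda>\<omega>. exp_B f \<Gamma> \<sigma> (\<lambda>t. W t \<omega>) ?s ?t (g \<omega>)) \<in> borel_measurable M"
    if g: "g \<in> borel_measurable M" for g
    unfolding exp_B_def
  proof (rule borel_measurable_solution_map[OF drift_B_lipschitz[OF L G] st(2) _ _ g])
    fix \<omega> assume "\<omega> \<in> space M"
    then show "continuous_on {?s..?t} (noise \<sigma> (\<lambda>t. W t \<omega>))"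
      by (intro continuous_on_noise continuous_on_subset[OF brownian_continuous[OF W]]) (use st in auto)
  next
    fix r assume "r \<in> {?s..?t}"
    then have r: "W r \<in> borel_measurable M" using st by (intro brownian_measurable[OF W]) auto
    have "(\<lambda>y. (0 :: real ^ 'n, \<sigma> *v y)) \<in> borel_measurable borel"
      by (intro borel_measurable_continuous_onI continuous_intros
          bounded_linear.continuous_on[OF matrix_vector_mul_bounded_linear])
    from measurable_compose[OF r this]
    show "(\<lambda>\<omega>. noise \<sigma> (\<lambda>t. W t \<omega>) r) \<in> borel_measurable M" by (simp add: noise_def)
  qed
  show ?case
    unfolding theta_splitting.simps comp_def
    using h \<theta> by (intro A B Suc) auto
qed (use z in simp)

lemma quadrature_defect_component:
  fixes w :: "real \<Rightarrow> real ^ 'n"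
  assumes w: "continuous_on {0..} w" and h: "h \<ge> 0"
  shows "quadrature_defect \<theta> h w k $ i = quadrature_defect \<theta> h (\<lambda>t. w t $ i) k"
proof -
  have "w integrable_on {real k * h..real (Suc k) * h}"
    by (intro integrable_continuous_real continuous_on_subset[OF w]) (use h in auto)
  from integral_linear[OF this bounded_linear_vec_nth[of i]]
  show ?thesis by (simp add: quadrature_defect_def comp_def del: of_nat_Suc)
qed

lemma theta_splitting_strong_order:
  fixes W :: "real \<Rightarrow> 'w \<Rightarrow> real ^ 'n" and z :: "real \<Rightarrow> 'w \<Rightarrow> (real ^ 'n) \<times> (real ^ 'n)"
  assumes W: "standard_brownian_motion M W" and T: "T > 0" and L: "L-lipschitz_on UNIV f"
    and z: "langevin_solution M f \<Gamma> \<sigma> W T z" and z0: "integrable M (z 0)"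
    and \<theta>: "0 \<le> \<theta>" "\<theta> \<le> 1"
  shows "has_strong_order M T z (\<lambda>h k \<omega>. theta_splitting \<theta> f \<Gamma> \<sigma> (\<lambda>t. W t \<omega>) (z 0 \<omega>) h k) 1"
proof -
  have Wi: "standard_brownian_motion_1 M (\<lambda>t \<omega>. W t \<omega> $ i)" for i
    using W by (auto simp: standard_brownian_motion_def)
  interpret prob_space M using Wi by (auto simp: standard_brownian_motion_1_def)
  obtain G where G: "G \<ge> 0" "\<And>u. norm (\<Gamma> *v u) \<le> G * norm u"
    using matrix_vector_bound[of \<Gamma>] by blast
  obtain S where S: "S \<ge> 0" "\<And>u. norm (\<sigma> *v u) \<le> S * norm u"
    using matrix_vector_bound[of \<sigma>] by blast
  let ?b = "langevin_drift f \<Gamma>"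
  define K where "K = 1 + 2 * (L * (1 + G * exp G) + G * exp G)"
  define c where "c = 2 * K + norm (f 0) + L + G"
  define D where "D i \<omega> = (SUP r\<in>{0..T}. \<bar>W r \<omega> $ i - W 0 \<omega> $ i\<bar>)" for i \<omega>
  have Di: "integrable M (D i)" for i
    unfolding D_def using brownian_sup_integrable[OF Wi T] .
  \<comment> \<open>An integrable bound for \<open>norm (z r)\<close> on \<open>[0, T]\<close>.\<close>
  define Z where "Z \<omega> = (norm (z 0 \<omega>) + S * (\<Sum>i\<in>UNIV. D i \<omega>) + norm (?b 0) * (T - 0)) * exp ((1 + L + G) * (T - 0))" for \<omega>
  have Zi: "integrable M Z"
    unfolding Z_def by (intro integrable_mult_left Bochner_Integration.integrable_add integrable_mult_right
        Bochner_Integration.integrable_sum integrable_norm z0 Di integrable_const)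
  have DW: "norm (noise \<sigma> (\<lambda>t. W t \<omega>) r - noise \<sigma> (\<lambda>t. W t \<omega>) 0) \<le> S * (\<Sum>i\<in>UNIV. D i \<omega>)"
    if \<omega>: "\<omega> \<in> space M" and r: "r \<in> {0..T}" for \<omega> r
  proof -
    have "noise \<sigma> (\<lambda>t. W t \<omega>) r - noise \<sigma> (\<lambda>t. W t \<omega>) 0 = (0, \<sigma> *v (W r \<omega> - W 0 \<omega>))"
      by (simp add: noise_def matrix_vector_mult_diff_distrib)
    then have "norm (noise \<sigma> (\<lambda>t. W t \<omega>) r - noise \<sigma> (\<lambda>t. W t \<omega>) 0) \<le> S * norm (W r \<omega> - W 0 \<omega>)"
      using S(2) by (simp add: norm_Pair)
    also have "norm (W r \<omega> - W 0 \<omega>) \<le> (\<Sum>i\<in>UNIV. \<bar>(W r \<omega> - W 0 \<omega>) $ i\<bar>)" by (rule norm_le_l1_cart)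
    also have "\<dots> \<le> (\<Sum>i\<in>UNIV. D i \<omega>)"
    proof (rule sum_mono)
      fix i
      have "continuous_on {0..T} (\<lambda>r. \<bar>W r \<omega> $ i - W 0 \<omega> $ i\<bar>)"
        by (intro continuous_intros continuous_on_subset[OF brownian_continuous[OF W \<omega>]]) auto
      then have "bdd_above ((\<lambda>r. \<bar>W r \<omega> $ i - W 0 \<omega> $ i\<bar>) ` {0..T})"
        by (intro bounded_imp_bdd_above compact_imp_bounded compact_continuous_image) auto
      then show "\<bar>(W r \<omega> - W 0 \<omega>) $ i\<bar> \<le> D i \<omega>"
        unfolding D_def using cSUP_upper[OF r] by simp
    qed
    finally show ?thesis using S(1) by (simp add: mult_left_mono)
  qed
  have sol: "AE \<omega> in M. solves ?b (noise \<sigma> (\<lambda>t. W t \<omega>)) 0 T (z 0 \<omega>) (\<lambda>t. z t \<omega>)"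
    using z by (simp add: langevin_solution_def)
  have ZZ: "AE \<omega> in M. \<forall>r\<in>{0..T}. norm (z r \<omega>) \<le> Z \<omega>"
    using sol AE_space
  proof eventually_elim
    fix \<omega> assume s: "solves ?b (noise \<sigma> (\<lambda>t. W t \<omega>)) 0 T (z 0 \<omega>) (\<lambda>t. z t \<omega>)" and \<omega>: "\<omega> \<in> space M"
    show "\<forall>r\<in>{0..T}. norm (z r \<omega>) \<le> Z \<omega>"
      unfolding Z_def using solves_norm_le[OF langevin_drift_lipschitz[OF L G] s DW[OF \<omega>]] by blast
  qed
  define C where "C = (S * (real CARD('n) * (4 * sqrt T)) + T * (c * (1 + expectation Z))) * exp (K * T)"
  show ?thesis
    unfolding has_strong_order_def
  proof (rule conjI, (rule exI[of _ 2], simp), rule exI[of _ C], rule exI[of _ 1], intro conjI allI impI)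
    fix h :: real and N :: nat assume hN: "0 < h \<and> h < 1 \<and> real N * h = T"
    then have h: "0 < h" "h \<le> 1" and N: "real N * h = T" by auto
    let ?err = "\<lambda>k \<omega>. norm (z (real k * h) \<omega> - theta_splitting \<theta> f \<Gamma> \<sigma> (\<lambda>t. W t \<omega>) (z 0 \<omega>) h k)"
    let ?sup = "\<lambda>\<omega>. SUP k\<in>{0..N}. ?err k \<omega>"
    define Q where "Q i \<omega> = Max ((\<lambda>K. \<bar>\<Sum>k<K. quadrature_defect \<theta> h (\<lambda>t. W t \<omega> $ i) k\<bar>) ` {..N})" for i \<omega>
    define R where "R \<omega> = S * (\<Sum>i\<in>UNIV. Q i \<omega>)" for \<omega>
    have Qi: "integrable M (Q i)" and Qe: "expectation (Q i) \<le> 4 * h * sqrt T" for i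
      unfolding Q_def using brownian_quadrature_defect_maximal[OF Wi h(1) \<theta>, where N = N] N by auto
    have Ri: "integrable M R" unfolding R_def using Qi by auto
    have Re: "expectation R \<le> S * (real CARD('n) * (4 * h * sqrt T))"
    proof -
      have "expectation R = S * (\<Sum>i\<in>UNIV. expectation (Q i))"
        unfolding R_def using Qi by (simp add: Bochner_Integration.integral_sum)
      also have "\<dots> \<le> S * (\<Sum>i\<in>(UNIV :: 'n set). 4 * h * sqrt T)"
        using S(1) Qe by (intro mult_left_mono sum_mono) auto
      finally show ?thesis by simp
    qed
    have RW: "norm (\<sigma> *v (\<Sum>j<k. quadrature_defect \<theta> h (\<lambda>t. W t \<omega>) j)) \<le> R \<omega>"
      if \<omega>: "\<omega> \<in> space M" and k: "k \<le> N" for \<omega> k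
    proof -
      let ?q = "\<Sum>j<k. quadrature_defect \<theta> h (\<lambda>t. W t \<omega>) j"
      have "norm (\<sigma> *v ?q) \<le> S * norm ?q" by (rule S)
      also have "norm ?q \<le> (\<Sum>i\<in>UNIV. \<bar>?q $ i\<bar>)" by (rule norm_le_l1_cart)
      also have "\<dots> \<le> (\<Sum>i\<in>UNIV. Q i \<omega>)"
      proof (rule sum_mono)
        fix i
        have "?q $ i = (\<Sum>j<k. quadrature_defect \<theta> h (\<lambda>t. W t \<omega> $ i) j)"
          using quadrature_defect_component[OF brownian_continuous[OF W \<omega>]] h by simp
        then show "\<bar>?q $ i\<bar> \<le> Q i \<omega>" unfolding Q_def using k by (intro Max_ge) auto
      qed
      finally show ?thesis unfolding R_def using S(1) by (simp add: mult_left_mono)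
    qed
    \<comment> \<open>The pathwise error bound; its expectation is \<open>O(h)\<close> because that of \<open>R\<close> is.\<close>
    define B where "B \<omega> = (R \<omega> + T * h * (c * (1 + Z \<omega>))) * exp (K * T)" for \<omega>
    have Bi: "integrable M B"
      unfolding B_def by (intro integrable_mult_left Bochner_Integration.integrable_add integrable_mult_right
          Ri Zi integrable_const)
    have err: "AE \<omega> in M. \<forall>k\<in>{0..N}. ?err k \<omega> \<le> B \<omega>"
      using ZZ sol AE_space
    proof eventually_elim
      fix \<omega> assume s: "solves ?b (noise \<sigma> (\<lambda>t. W t \<omega>)) 0 T (z 0 \<omega>) (\<lambda>t. z t \<omega>)" and \<omega>: "\<omega> \<in> space M"
        and Z: "\<forall>r\<in>{0..T}. norm (z r \<omega>) \<le> Z \<omega>"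
      show "\<forall>k\<in>{0..N}. ?err k \<omega> \<le> B \<omega>"
        using theta_splitting_error[OF L G h \<theta> N brownian_continuous[OF W \<omega>] s _ RW[OF \<omega>]] Z
        unfolding B_def c_def K_def by auto
    qed
    have supeq: "?sup \<omega> = Max ((\<lambda>k. ?err k \<omega>) ` {0..N})" for \<omega>
      by (rule cSup_eq_Max) auto
    have zm: "z (real k * h) \<in> borel_measurable M" if k: "k \<in> {0..N}" for k
    proof -
      have "real k * h \<le> real N * h" using k h by (intro mult_right_mono) auto
      then show ?thesis using z h N by (auto simp: langevin_solution_def)
    qed
    note Ym = theta_splitting_measurable[OF W L h(1) \<theta> borel_measurable_integrable[OF z0]]
    have errm: "?err k \<in> borel_measurable M" if "k \<in> {0..N}" for k
      by (rule measurable_compose[OF borel_measurable_diff[OF zm[OF that] Ym] borel_measurable_norm])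
    have supm: "?sup \<in> borel_measurable M"
      unfolding supeq by (rule borel_measurable_Max[OF finite_atLeastAtMost errm])
    have supB: "AE \<omega> in M. norm (?sup \<omega>) \<le> norm (B \<omega>)"
      using err
    proof eventually_elim
      fix \<omega> assume b: "\<forall>k\<in>{0..N}. ?err k \<omega> \<le> B \<omega>"
      have "0 \<le> ?sup \<omega>" unfolding supeq by (subst Max_ge_iff) auto
      moreover have "?sup \<omega> \<le> B \<omega>" unfolding supeq using b by (subst Max_le_iff) auto
      ultimately show "norm (?sup \<omega>) \<le> norm (B \<omega>)" by simp
    qed
    show supi: "integrable M ?sup"
      using Bi supm supB by (rule Bochner_Integration.integrable_bound)
    have "expectation ?sup \<le> expectation B"
    proof (rule integral_mono_AE[OF supi Bi])
      show "AE \<omega> in M. ?sup \<omega> \<le> B \<omega>"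
        using err by eventually_elim (auto simp: supeq)
    qed
    also have "\<dots> = (expectation R + T * h * (c * (1 + expectation Z))) * exp (K * T)"
      unfolding B_def using Ri Zi by (simp add: prob_space)
    also have "\<dots> \<le> (S * (real CARD('n) * (4 * h * sqrt T)) + T * h * (c * (1 + expectation Z))) * exp (K * T)"
      by (intro mult_right_mono[OF add_right_mono[OF Re]]) simp
    also have "\<dots> = C * h powr 1"
      using h by (simp add: C_def algebra_simps)
    finally show "expectation ?sup \<le> C * h powr 1" .
  qed auto
qed

theorem theorem3p2:
  fixes M :: "'w measure"
    and W :: "real \<Rightarrow> 'w \<Rightarrow> real ^ 'n"
    and f :: "real ^ 'n \<Rightarrow> real ^ 'n"
    and \<Gamma> \<sigma> :: "real ^ 'n ^ 'n"
    and k\<^sub>B \<Theta> T :: real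
    and z :: "real \<Rightarrow> 'w \<Rightarrow> (real ^ 'n) \<times> (real ^ 'n)"
  assumes "standard_brownian_motion M W"
    and "T > 0" and "k\<^sub>B > 0" and "\<Theta> \<ge> 0"
    and "has_bounded_second_derivatives f"
    and Lipschitz: "\<exists>L. L-lipschitz_on UNIV f"
    and "\<sigma> ** transpose \<sigma> = (2 * k\<^sub>B * \<Theta>) *\<^sub>R \<Gamma>"
    and "langevin_solution M f \<Gamma> \<sigma> W T z"
    and "integrable M (z 0)"
  shows "has_strong_order M T z
           (\<lambda>h k \<omega>. symmetric_splitting f \<Gamma> \<sigma> (\<lambda>t. W t \<omega>) (z 0 \<omega>) h k) 1 \<and>
         has_strong_order M T z
           (\<lambda>h k \<omega>. nonsymmetric_splitting f \<Gamma> \<sigma> (\<lambda>t. W t \<omega>) (z 0 \<omega>) h k) 1"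
proof -
  obtain L where L: "L-lipschitz_on UNIV f" using Lipschitz by blast
  note theta = theta_splitting_strong_order[OF assms(1,2) L assms(8,9)]
  show ?thesis
    unfolding symmetric_splitting_eq_theta nonsymmetric_splitting_eq_theta
    by (intro conjI theta) simp_all
qed

end
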